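(* For every nonempty bounded domain $U\subset \mathrm{SL}(2,\mathbb{C})$ there exists a complete holomorphic Legendrian immersion $E\colon \mathbb{D}_1\to \mathrm{SL}(2,\mathbb{C})$ of the unit disk $\mathbb{D}_1=\{z\in\mathbb{C}: |z|<1\}$ such that $E(\mathbb{D}_1)\subset U$.
   Context: Elements of $\mathrm{SL}(2,\mathbb{C})$ are written as matrices $(x_{ij})_{i,j=1,2}$. A holomorphic map $E\colon\mathbb{D}_1\to\mathrm{SL}(2,\mathbb{C})$ is called Legendrian if $E^*\Omega_{\mathrm{SL}}=0$ on $\mathbb{D}_1$, where $\Omega_{\mathrm{SL}}:=x_{11}\,dx_{22}-x_{12}\,dx_{21}$ is a complex contact form on $\mathrm{SL}(2,\mathbb{C})$. A holomorphic immersion $E$ is called complete if the pull-back $E^*g_{\mathrm{SL}}$ is a complete Riemannian metric on $\mathbb{D}_1$, where $g_{\mathrm{SL}}$ is the canonical (left-invariant) Hermitian metric on $\mathrm{SL}(2,\mathbb{C})$, for which $E^*g_{\mathrm{SL}}=|E^{-1}E'|^2\,|dz|^2$ with $|A|^2=\operatorname{trace}(AA^* )$ and $A^*={}^t\bar A$. "Bounded" refers to $\mathrm{SL}(2,\mathbb{C})$ as a subset of the space of $2\times 2$ complex matrices. *)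

theory Defs
  imports "HOL-Analysis.Analysis"
begin

section \<open>The group and its contact form\<close>

definition SL2C :: "(complex^2^2) set" where
  "SL2C = {x. det x = 1}"

definition Omega_SL :: "complex^2^2 \<Rightarrow> complex^2^2 \<Rightarrow> complex" where
  "Omega_SL x v = x$1$1 * v$2$2 - x$1$2 * v$2$1"

text \<open>The form \<open>Omega_SL x\<close> is evaluated on a tangent vector \<open>v\<close> at \<open>x\<close>.\<close>


section \<open>Holomorphic maps into matrices\<close>

definition holomorphic_matrix_on :: "(complex \<Rightarrow> complex^2^2) \<Rightarrow> complex set \<Rightarrow> bool" where
  "holomorphic_matrix_on E D \<longleftrightarrow> (\<forall>i j. (\<lambda>z. E z $ i $ j) holomorphic_on D)"

definition matrix_deriv :: "(complex \<Rightarrow> complex^2^2) \<Rightarrow> complex \<Rightarrow> complex^2^2" where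
  "matrix_deriv E z = (\<chi> i j. deriv (\<lambda>w. E w $ i $ j) z)"

lemma has_derivative_vec:
  fixes f :: "'a::real_normed_vector \<Rightarrow> 'b::euclidean_space^'n"
  assumes "\<And>i. ((\<lambda>w. f w $ i) has_derivative (\<lambda>v. f' v $ i)) (at z)"
  shows "(f has_derivative f') (at z)"
proof (subst has_derivative_componentwise_within, rule ballI)
  fix b :: "'b^'n" assume "b \<in> Basis"
  then obtain i u where b: "b = axis i u"
    by (auto simp: Basis_vec_def)
  show "((\<lambda>x. f x \<bullet> b) has_derivative (\<lambda>x. f' x \<bullet> b)) (at z)"
    unfolding b inner_axis by (rule has_derivative_inner_left[OF assms])
qed

lemma has_derivative_holomorphic_matrix:
  assumes "holomorphic_matrix_on E D" "open D" "z \<in> D"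
  shows "(E has_derivative (\<lambda>v. \<chi> i j. v * matrix_deriv E z $ i $ j)) (at z)"
proof -
  have "((\<lambda>w. E w $ i $ j) has_derivative (\<lambda>v. v * deriv (\<lambda>w. E w $ i $ j) z)) (at z)" for i j
    using holomorphic_derivI[of "\<lambda>w. E w $ i $ j" D z] assms
    by (simp add: holomorphic_matrix_on_def has_field_derivative_def mult.commute[of _ "deriv _ _"])
  then show ?thesis
    by (intro has_derivative_vec) (simp add: matrix_deriv_def)
qed

lemma frechet_derivative_holomorphic_matrix:
  assumes "holomorphic_matrix_on E D" "open D" "z \<in> D"
  shows "frechet_derivative E (at z) = (\<lambda>v. \<chi> i j. v * matrix_deriv E z $ i $ j)"
  using frechet_derivative_at[OF has_derivative_holomorphic_matrix[OF assms]] by simp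

definition immersion_on :: "(complex \<Rightarrow> complex^2^2) \<Rightarrow> complex set \<Rightarrow> bool" where
  "immersion_on E D \<longleftrightarrow> (\<forall>z\<in>D. inj (frechet_derivative E (at z)))"

text \<open>Legendrian: the pull-back of \<^const>\<open>Omega_SL\<close> under \<open>E\<close> vanishes on \<open>D\<close>.\<close>

definition Legendrian_on :: "(complex \<Rightarrow> complex^2^2) \<Rightarrow> complex set \<Rightarrow> bool" where
  "Legendrian_on E D \<longleftrightarrow> (\<forall>z\<in>D. \<forall>v. Omega_SL (E z) (frechet_derivative E (at z) v) = 0)"


section \<open>Complete conformal metrics\<close>

text \<open>
  A conformal Riemannian metric \<open>\<rho>(z)\<^sup>2 |dz|\<^sup>2\<close> on \<open>D\<close> is given by its density \<open>\<rho>\<close>. The paths of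
  \<^const>\<open>valid_path\<close> may have unbounded derivative near the finitely many exceptional parameters,
  so they need not be rectifiable. Finite length is therefore imposed through \<open>has_integral\<close>:
  the operator \<^const>\<open>integral\<close> would assign length 0 to a path of infinite length.
\<close>

definition path_length_is :: "(complex \<Rightarrow> real) \<Rightarrow> (real \<Rightarrow> complex) \<Rightarrow> real \<Rightarrow> bool" where
  "path_length_is \<rho> \<gamma> L \<longleftrightarrow>
     ((\<lambda>t. \<rho> (\<gamma> t) * norm (vector_derivative \<gamma> (at t))) has_integral L) {0..1}"

definition path_lengths ::
    "complex set \<Rightarrow> (complex \<Rightarrow> real) \<Rightarrow> complex \<Rightarrow> complex \<Rightarrow> real set" where
  "path_lengths D \<rho> p q =
     {L. \<exists>\<gamma>. valid_path \<gamma> \<and> path_image \<gamma> \<subseteq> D \<and> pathstart \<gamma> = p \<and> pathfinish \<gamma> = q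
           \<and> path_length_is \<rho> \<gamma> L}"

text \<open>The value 0 outside \<open>D\<close> is a convention, required because \<^locale>\<open>Metric_space\<close> asks for
  nonnegativity everywhere.\<close>

definition conformal_dist ::
    "complex set \<Rightarrow> (complex \<Rightarrow> real) \<Rightarrow> complex \<Rightarrow> complex \<Rightarrow> real" where
  "conformal_dist D \<rho> p q = (if p \<in> D \<and> q \<in> D then Inf (path_lengths D \<rho> p q) else 0)"

text \<open>The first conjunct only makes \<^const>\<open>Metric_space.mcomplete\<close> meaningful; it holds for every
  continuous positive density on a connected open set (\<open>Metric_space_conformal_dist\<close> below).\<close>

definition complete_conformal_metric :: "complex set \<Rightarrow> (complex \<Rightarrow> real) \<Rightarrow> bool" where
  "complete_conformal_metric D \<rho> \<longleftrightarrow>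
     Metric_space D (conformal_dist D \<rho>) \<and> Metric_space.mcomplete D (conformal_dist D \<rho>)"

lemma path_length_is_nonneg:
  assumes "path_length_is \<rho> \<gamma> L" "path_image \<gamma> \<subseteq> D" "\<And>z. z \<in> D \<Longrightarrow> 0 \<le> \<rho> z"
  shows "0 \<le> L"
  using assms(1) unfolding path_length_is_def
  by (rule has_integral_nonneg)
     (use assms(2,3) in \<open>auto simp: path_image_def image_subset_iff intro!: mult_nonneg_nonneg\<close>)

lemma path_length_is_reversepath:
  assumes "valid_path \<gamma>" "path_length_is \<rho> \<gamma> L"
  shows "path_length_is \<rho> (reversepath \<gamma>) L"
proof -
  obtain S where S: "finite S" "\<gamma> C1_differentiable_on {0..1} - S"
    using assms by (auto simp: valid_path_def piecewise_C1_differentiable_on_def)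
  have d: "norm (vector_derivative (\<lambda>x. \<gamma> (1 - x)) (at x)) = norm (vector_derivative \<gamma> (at (1 - x)))"
    if x: "x \<in> {0..1}" "x \<notin> (\<lambda>x. 1 - x) ` S" for x
  proof -
    have "1 - x \<notin> S"
      using x(2) by (force simp: image_iff)
    then obtain f' where f': "(\<gamma> has_vector_derivative f') (at (1 - x))"
      using S(2) x(1) by (force simp: C1_differentiable_on_def)
    have "(\<gamma> \<circ> (\<lambda>x. 1 - x) has_vector_derivative -1 *\<^sub>R f') (at x)"
      by (intro vector_diff_chain_within has_vector_derivative_at_within [OF f'] derivative_eq_intros | simp)+
    then have "((\<lambda>x. \<gamma> (1 - x)) has_vector_derivative -f') (at x)"
      by (simp add: o_def)
    then show ?thesis
      using f' by (simp add: vector_derivative_at)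
  qed
  have "((\<lambda>x. \<rho> (\<gamma> (1 - x)) * norm (vector_derivative \<gamma> (at (1 - x)))) has_integral L) {0..1}"
    using has_integral_affinity01 [where m= "-1" and c=1, OF assms(2)[unfolded path_length_is_def]]
    by simp
  then show ?thesis
    unfolding path_length_is_def reversepath_def
    by (rule has_integral_spike_finite [where S = "(\<lambda>x. 1 - x) ` S", rotated 2])
       (use S d in auto)
qed

lemma path_length_is_join:
  assumes L1: "path_length_is \<rho> g1 i1" and L2: "path_length_is \<rho> g2 i2"
    and "valid_path g1" "valid_path g2"
  shows "path_length_is \<rho> (g1 +++ g2) (i1 + i2)"
proof -
  obtain s1 s2
    where s1: "finite s1" "\<forall>x\<in>{0..1} - s1. g1 differentiable at x"
      and s2: "finite s2" "\<forall>x\<in>{0..1} - s2. g2 differentiable at x"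
    using assms
    by (auto simp: valid_path_def piecewise_C1_differentiable_on_def C1_differentiable_on_eq)
  have i1: "((\<lambda>x. 2 * (\<rho> (g1 (2*x)) * norm (vector_derivative g1 (at (2*x))))) has_integral i1) {0..1/2}"
   and i2: "((\<lambda>x. 2 * (\<rho> (g2 (2*x - 1)) * norm (vector_derivative g2 (at (2*x - 1))))) has_integral i2) {1/2..1}"
    using has_integral_affinity01 [OF L1[unfolded path_length_is_def], where m= 2 and c=0, THEN has_integral_cmul [where c=2]]
          has_integral_affinity01 [OF L2[unfolded path_length_is_def], where m= 2 and c="-1", THEN has_integral_cmul [where c=2]]
    by (simp_all only: image_affinity_atLeastAtMost_div_diff, simp_all)
  have g1: "vector_derivative (\<lambda>x. if x*2 \<le> 1 then g1 (2*x) else g2 (2*x - 1)) (at z) =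
            2 *\<^sub>R vector_derivative g1 (at (z*2))"
      if "0 \<le> z" "z*2 < 1" "z*2 \<notin> s1" for z
  proof (rule vector_derivative_at [OF has_vector_derivative_transform_within])
    show "0 < \<bar>z - 1/2\<bar>"
      using that by auto
    have "((*) 2 has_vector_derivative 2) (at z)"
      by (simp add: has_vector_derivative_def has_derivative_def bounded_linear_mult_left)
    moreover have "(g1 has_vector_derivative vector_derivative g1 (at (z * 2))) (at (2 * z))"
      using s1 that by (auto simp: algebra_simps vector_derivative_works)
    ultimately
    show "((\<lambda>x. g1 (2 * x)) has_vector_derivative 2 *\<^sub>R vector_derivative g1 (at (z * 2))) (at z)"
      by (intro vector_diff_chain_at [simplified o_def])
  qed (use that in \<open>simp_all add: dist_real_def abs_if split: if_split_asm\<close>)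
  have g2: "vector_derivative (\<lambda>x. if x*2 \<le> 1 then g1 (2*x) else g2 (2*x - 1)) (at z) =
            2 *\<^sub>R vector_derivative g2 (at (z*2 - 1))"
           if "1 < z*2" "z \<le> 1" "z*2 - 1 \<notin> s2" for z
  proof (rule vector_derivative_at [OF has_vector_derivative_transform_within])
    show "0 < \<bar>z - 1/2\<bar>"
      using that by auto
    have "((\<lambda>x. 2 * x - 1) has_vector_derivative 2) (at z)"
      by (simp add: has_vector_derivative_def has_derivative_def bounded_linear_mult_left)
    moreover have "(g2 has_vector_derivative vector_derivative g2 (at (z * 2 - 1))) (at (2 * z - 1))"
      using s2 that by (auto simp: algebra_simps vector_derivative_works)
    ultimately
    show "((\<lambda>x. g2 (2 * x - 1)) has_vector_derivative 2 *\<^sub>R vector_derivative g2 (at (z * 2 - 1))) (at z)"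
      by (intro vector_diff_chain_at [simplified o_def])
  qed (use that in \<open>simp_all add: dist_real_def abs_if split: if_split_asm\<close>)
  let ?F = "\<lambda>x. \<rho> ((g1 +++ g2) x) * norm (vector_derivative (g1 +++ g2) (at x))"
  have "(?F has_integral i1) {0..1/2}"
  proof (rule has_integral_spike_finite [OF _ _ i1])
    show "finite (insert (1/2) ((*) 2 -` s1))"
      using s1 by (force intro: finite_vimageI [where h = "(*)2"] inj_onI)
  qed (auto simp add: joinpaths_def mult_ac g1)
  moreover have "(?F has_integral i2) {1/2..1}"
  proof (rule has_integral_spike_finite [OF _ _ i2])
    show "finite (insert (1/2) ((\<lambda>x. 2 * x - 1) -` s2))"
      using s2 by (force intro: finite_vimageI [where h = "\<lambda>x. 2*x-1"] inj_onI)
  qed (auto simp add: joinpaths_def mult_ac g2)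
  ultimately show ?thesis
    unfolding path_length_is_def by (simp add: has_integral_combine [where c = "1/2"])
qed

lemma path_lengths_nonempty:
  assumes "open D" "connected D" "continuous_on D \<rho>" "p \<in> D" "q \<in> D"
  shows "path_lengths D \<rho> p q \<noteq> {}"
proof -
  obtain g where g: "polynomial_function g" "path_image g \<subseteq> D" "pathstart g = p" "pathfinish g = q"
    using connected_open_polynomial_connected[OF assms(1,2,4,5)] by blast
  obtain g' where g': "polynomial_function g'" "\<And>x. (g has_vector_derivative g' x) (at x)"
    using has_vector_derivative_polynomial_function[OF g(1)] by blast
  have "continuous_on {0..1} (\<lambda>t. \<rho> (g t) * norm (g' t))"
    using g g' by (intro continuous_intros continuous_on_compose2[OF assms(3)]
        continuous_on_polymonial_function) (auto simp: path_image_def)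
  then have "path_length_is \<rho> g (integral {0..1} (\<lambda>t. \<rho> (g t) * norm (g' t)))"
    unfolding path_length_is_def vector_derivative_at[OF g'(2)]
    by (intro integrable_integral integrable_continuous_interval)
  moreover have "valid_path g"
    unfolding valid_path_def
    by (rule C1_differentiable_imp_piecewise)
       (use g' continuous_on_polymonial_function in \<open>auto simp: C1_differentiable_on_def\<close>)
  ultimately show ?thesis
    using g unfolding path_lengths_def by blast
qed

lemma path_length_lower_bound:
  assumes cont: "continuous_on D \<rho>" and pos: "\<And>z. z \<in> D \<Longrightarrow> 0 < \<rho> z"
    and ball: "cball p r \<subseteq> D" "0 < r" "r \<le> dist p q"
  obtains c where "0 < c" "\<And>L. L \<in> path_lengths D \<rho> p q \<Longrightarrow> c \<le> L"
proof -
  obtain z0 where z0: "z0 \<in> cball p r" "\<And>z. z \<in> cball p r \<Longrightarrow> \<rho> z0 \<le> \<rho> z"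
    using continuous_attains_inf[of "cball p r" \<rho>] continuous_on_subset[OF cont ball(1)] ball(2)
    by auto
  show thesis
  proof
    show "0 < \<rho> z0 * r"
      using pos z0 ball by auto
    fix L assume "L \<in> path_lengths D \<rho> p q"
    then obtain g where g: "valid_path g" "path_image g \<subseteq> D" "g 0 = p" "g 1 = q"
        and L: "((\<lambda>t. \<rho> (g t) * norm (vector_derivative g (at t))) has_integral L) {0..1}"
      by (auto simp: path_lengths_def path_length_is_def pathstart_def pathfinish_def)
    obtain S where S: "continuous_on {0..1} g" "finite S" "g C1_differentiable_on {0..1} - S"
      using g(1) by (auto simp: valid_path_def piecewise_C1_differentiable_on_def)
    define K where "K = {t \<in> {0..1}. r \<le> dist p (g t)}"
    have "continuous_on {0..1} (\<lambda>t. dist p (g t))"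
      using S(1) by (intro continuous_intros)
    then have "closed ({0..1} \<inter> (\<lambda>t. dist p (g t)) -` {r..})"
      by (intro continuous_closed_preimage) auto
    moreover have "{0..1} \<inter> (\<lambda>t. dist p (g t)) -` {r..} = K"
      by (auto simp: K_def)
    ultimately have "closed K"
      by simp
    moreover have "K \<subseteq> {0..1}"
      by (auto simp: K_def)
    ultimately have "compact K"
      by (metis compact_Icc compact_Int_closed inf.absorb_iff2)
    moreover have "1 \<in> K"
      using ball g by (simp add: K_def)
    ultimately obtain T where T: "T \<in> K" "\<And>t. t \<in> K \<Longrightarrow> T \<le> t"
      using compact_attains_inf[of K] by blast
    have T01: "0 \<le> T" "T \<le> 1" "r \<le> dist p (g T)"
      using T(1) by (auto simp: K_def)
    have inb: "g t \<in> cball p r" if "t \<in> {0..<T}" for t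
    proof (rule ccontr)
      assume "g t \<notin> cball p r"
      then have "t \<in> K" using that T01 by (auto simp: K_def)
      then show False using T(2)[of t] that by auto
    qed
    let ?f = "\<lambda>t. \<rho> (g t) * norm (vector_derivative g (at t))"
    have int: "?f integrable_on {0..1}" using L by blast
    then have intT: "?f integrable_on {0..T}"
      by (rule integrable_on_subinterval) (use T01 in auto)
    have nn: "0 \<le> ?f t" if "t \<in> {0..1}" for t
      using pos[of "g t"] that g(2) by (force simp: path_image_def)
    have "integral {0..T} ?f \<le> L"
      using integral_subset_le[OF _ intT int] nn T01 L by (auto simp: integral_unique)
    have ftc: "((\<lambda>t. vector_derivative g (at t)) has_integral (g T - g 0)) {0..T}"
    proof (rule fundamental_theorem_of_calculus_interior_strong[OF S(2) T01(1)])
      show "continuous_on {0..T} g"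
        using S(1) by (rule continuous_on_subset) (use T01 in auto)
      fix t assume "t \<in> {0<..<T} - S"
      then have "g differentiable at t"
        using S(3) T01 by (auto simp: C1_differentiable_on_eq)
      then show "(g has_vector_derivative vector_derivative g (at t)) (at t)"
        by (simp add: vector_derivative_works)
    qed
    define h where "h = (\<lambda>t. if t = T then 0 else vector_derivative g (at t))"
    have h: "(h has_integral (g T - g 0)) {0..T}"
      by (rule has_integral_spike_finite[OF _ _ ftc, of "{T}"]) (auto simp: h_def)
    have z0pos: "0 < \<rho> z0"
      using pos z0(1) ball(1) by auto
    have le: "norm (\<rho> z0 *\<^sub>R h t) \<le> ?f t" if t: "t \<in> {0..T}" for t
    proof (cases "t = T")
      case True
      then show ?thesis using nn[of t] t T01 by (simp add: h_def)
    next
      case False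
      then have "\<rho> z0 \<le> \<rho> (g t)"
        using z0(2) inb[of t] t by auto
      then show ?thesis
        using False z0pos by (auto simp: h_def intro!: mult_right_mono)
    qed
    have "norm (integral {0..T} (\<lambda>t. \<rho> z0 *\<^sub>R h t)) \<le> integral {0..T} ?f"
      using has_integral_cmul[OF h]
      by (intro integral_norm_bound_integral[OF _ intT le] has_integral_integrable)
    moreover have "integral {0..T} (\<lambda>t. \<rho> z0 *\<^sub>R h t) = \<rho> z0 *\<^sub>R (g T - g 0)"
      using h by (simp add: integral_unique)
    moreover have "norm (g T - g 0) \<ge> r"
      using T01(3) g(3) by (simp add: dist_norm norm_minus_commute)
    moreover have "norm (\<rho> z0 *\<^sub>R (g T - g 0)) = \<rho> z0 * norm (g T - g 0)"
      using z0pos by simp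
    moreover have "\<rho> z0 * r \<le> \<rho> z0 * norm (g T - g 0)"
      using calculation(3) z0pos by (intro mult_left_mono) auto
    ultimately show "\<rho> z0 * r \<le> L"
      using \<open>integral {0..T} ?f \<le> L\<close> by (metis order.trans)
  qed
qed

lemma Metric_space_conformal_dist:
  assumes "open D" "connected D" and cont: "continuous_on D \<rho>"
    and pos: "\<And>z. z \<in> D \<Longrightarrow> 0 < \<rho> z"
  shows "Metric_space D (conformal_dist D \<rho>)"
proof -
  have nn: "0 \<le> L" if L: "L \<in> path_lengths D \<rho> p q" for p q L
  proof -
    obtain g where "path_length_is \<rho> g L" "path_image g \<subseteq> D"
      using L by (auto simp: path_lengths_def)
    then show ?thesis
      using path_length_is_nonneg pos less_imp_le by metis
  qed
  then have bdd: "bdd_below (path_lengths D \<rho> p q)" for p q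
    by (meson bdd_belowI)
  have ne: "path_lengths D \<rho> p q \<noteq> {}" if "p \<in> D" "q \<in> D" for p q
    using path_lengths_nonempty assms(1,2,3) that by blast
  have comm: "path_lengths D \<rho> p q \<subseteq> path_lengths D \<rho> q p" for p q
  proof
    fix L assume "L \<in> path_lengths D \<rho> p q"
    then obtain g where "valid_path g" "path_image g \<subseteq> D" "pathstart g = p" "pathfinish g = q"
      "path_length_is \<rho> g L"
      by (auto simp: path_lengths_def)
    then show "L \<in> path_lengths D \<rho> q p"
      using path_length_is_reversepath[of g \<rho> L] unfolding path_lengths_def
      by (auto intro!: exI[of _ "reversepath g"] simp: valid_path_imp_reverse)
  qed
  show ?thesis
  proof
    fix x y
    show "0 \<le> conformal_dist D \<rho> x y"
      using cInf_greatest[OF ne nn] by (simp add: conformal_dist_def)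
    show "conformal_dist D \<rho> x y = conformal_dist D \<rho> y x"
      using comm[of x y] comm[of y x] by (simp add: conformal_dist_def)
  next
    fix x y assume xy: "x \<in> D" "y \<in> D"
    show "conformal_dist D \<rho> x y = 0 \<longleftrightarrow> x = y"
    proof
      assume 0: "conformal_dist D \<rho> x y = 0"
      show "x = y"
      proof (rule ccontr)
        assume "x \<noteq> y"
        obtain e where e: "0 < e" "cball x e \<subseteq> D"
          using \<open>open D\<close> xy open_contains_cball by blast
        define r where "r = min e (dist x y)"
        have r: "cball x r \<subseteq> D" "0 < r" "r \<le> dist x y"
          using e \<open>x \<noteq> y\<close> by (auto simp: r_def)
        obtain c where "0 < c" "\<And>L. L \<in> path_lengths D \<rho> x y \<Longrightarrow> c \<le> L"
          using path_length_lower_bound[OF cont pos r] by blast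
        then have "0 < conformal_dist D \<rho> x y"
          using cInf_greatest[OF ne[OF xy], of c] xy by (simp add: conformal_dist_def)
        with 0 show False by simp
      qed
    next
      assume "x = y"
      have "path_length_is \<rho> (linepath x x) 0"
        by (simp add: path_length_is_def)
      then have "0 \<in> path_lengths D \<rho> x y"
        using xy \<open>x = y\<close> unfolding path_lengths_def
        by (auto intro!: exI[of _ "linepath x x"])
      then have "Inf (path_lengths D \<rho> x y) \<le> 0"
        by (rule cInf_lower[OF _ bdd])
      moreover have "0 \<le> Inf (path_lengths D \<rho> x y)"
        using cInf_greatest[OF ne[OF xy] nn] by simp
      ultimately show "conformal_dist D \<rho> x y = 0"
        using xy by (simp add: conformal_dist_def)
    qed
  next
    fix x y z assume xyz: "x \<in> D" "y \<in> D" "z \<in> D"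
    have sum: "Inf (path_lengths D \<rho> x z) \<le> L1 + L2"
      if L: "L1 \<in> path_lengths D \<rho> x y" "L2 \<in> path_lengths D \<rho> y z" for L1 L2
    proof -
      obtain g1 where 1: "valid_path g1" "path_image g1 \<subseteq> D" "pathstart g1 = x" "pathfinish g1 = y"
          "path_length_is \<rho> g1 L1"
        using L(1) by (auto simp: path_lengths_def)
      obtain g2 where 2: "valid_path g2" "path_image g2 \<subseteq> D" "pathstart g2 = y" "pathfinish g2 = z"
          "path_length_is \<rho> g2 L2"
        using L(2) by (auto simp: path_lengths_def)
      have "L1 + L2 \<in> path_lengths D \<rho> x z"
        unfolding path_lengths_def mem_Collect_eq
        using 1 2 path_length_is_join[OF 1(5) 2(5) 1(1) 2(1)]
        by (intro exI[of _ "g1 +++ g2"]) (auto simp: valid_path_join path_image_join)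
      then show ?thesis
        by (rule cInf_lower[OF _ bdd])
    qed
    have "Inf (path_lengths D \<rho> x z) - L1 \<le> Inf (path_lengths D \<rho> y z)"
      if "L1 \<in> path_lengths D \<rho> x y" for L1
      by (rule cInf_greatest[OF ne[OF xyz(2,3)]]) (use sum[OF that] in force)
    then have "Inf (path_lengths D \<rho> x z) - Inf (path_lengths D \<rho> y z) \<le> Inf (path_lengths D \<rho> x y)"
      by (intro cInf_greatest[OF ne[OF xyz(1,2)]]) force
    then show "conformal_dist D \<rho> x z \<le> conformal_dist D \<rho> x y + conformal_dist D \<rho> y z"
      using xyz by (simp add: conformal_dist_def)
  qed
qed

section \<open>The pulled-back metric\<close>

definition matrix_adjoint :: "complex^2^2 \<Rightarrow> complex^2^2" where
  "matrix_adjoint A = (\<chi> i j. cnj (A $ j $ i))"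

definition matrix_abs :: "complex^2^2 \<Rightarrow> real" where
  "matrix_abs A = sqrt (Re (trace (A ** matrix_adjoint A)))"

definition SL_density :: "(complex \<Rightarrow> complex^2^2) \<Rightarrow> complex \<Rightarrow> real" where
  "SL_density E z = matrix_abs (matrix_inv (E z) ** matrix_deriv E z)"

definition complete_on :: "(complex \<Rightarrow> complex^2^2) \<Rightarrow> complex set \<Rightarrow> bool" where
  "complete_on E D \<longleftrightarrow> complete_conformal_metric D (SL_density E)"

end

(* In suitable Darboux coordinates a Legendrian curve is a triple (u, v, s) with
   s' = v u' - u v', and (u, v, s) may be replaced by (c u, c v, c^2 s), so a bounded triple on
   the disc suffices.  It is a limit of polynomial triples.  The function
   Phi = (|u|^2 + |v|^2 - 1)^2 + |s|^2 has the feature that its complex differential does not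
   vanish on the contact plane at any point with 0 < Phi < 1.  On the unit circle one
   therefore finds a nonvanishing direction in the contact plane along which Phi is stationary
   for all complex multiples.  That direction is a Laurent polynomial, and multiplying it by
   a z^N with N large makes it an admissible polynomial perturbation: it changes Phi by O(a^2)
   on the circle but makes every path crossing a thin annulus longer by a constant times a.
   With a_n of order 1/n the sum of a_n^2 is small and the sum of a_n diverges, which gives
   boundedness (maximum principle) and completeness. *)
theory Submission
  imports Defs "HOL-Complex_Analysis.Complex_Analysis" "HOL-Real_Asymp.Real_Asymp"
begin

section \<open>Completeness of radial conformal metrics\<close>

text \<open>The stationary direction involves conjugates of u, v, s, so it is not holomorphic; it is
  realised only on the circle, where \<open>cnj z\<close> = 1/z. Phi is not plurisubharmonic, so
  nothing is claimed about it inside the disc: the maximum principle is applied to u, v and s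
  separately. The third coordinate cannot be chosen, being a primitive of v u' - u v'. If M = a z^m
  times polynomials P, Q is added to u, v, integration by parts shows that its change is M (v P - u
  Q), the s-component of the stationary direction, plus a primitive of M and M^2 times polynomials
  independent of m, hence O(1/m). The derivative of M has size a m where |z|^m \<ge> 1/2, on an
  annulus of width of order 1/m, so the length gained does not depend on m. In the group the contact
  form is right-invariant but the metric left-invariant: a curve near the identity is brought into U
  by right multiplication, and boundedness of U limits the cost to a constant factor in the
  metric.\<close>

lemma continuous_crossing:
  fixes g :: "real \<Rightarrow> real"
  assumes cont: "continuous_on {a..b} g" and "a \<le> b" "g a \<le> p" "q \<le> g b" "p < q"
  obtains s t where "a \<le> s" "s \<le> t" "t \<le> b" "g s = p" "g t = q" "\<And>x. x \<in> {s..t} \<Longrightarrow> p \<le> g x"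
proof -
  \<comment> \<open>The last time s with g \<le> p works: g stays above p afterwards, so any later t
    with g t = q will do.\<close>
  define S where "S = {a..b} \<inter> g -` {..p}"
  have "compact S"
    unfolding S_def using continuous_closed_preimage[OF cont, of "{..p}"] compact_Int_closed[of "{a..b}"]
    by (metis closed_atLeastAtMost closed_atMost compact_Icc inf.left_idem)
  moreover have "a \<in> S" using assms by (auto simp: S_def)
  ultimately obtain s where s: "s \<in> S" "\<And>x. x \<in> S \<Longrightarrow> x \<le> s"
    using compact_attains_sup[of S] by blast
  have sab: "a \<le> s" "s \<le> b" "g s \<le> p" using s(1) by (auto simp: S_def)
  have above: "p < g x" if "s < x" "x \<le> b" for x
    using s(2)[of x] that sab by (force simp: S_def)
  have cs: "continuous_on {s..b} g" using cont by (rule continuous_on_subset) (use sab in auto)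
  obtain s' where s': "s \<le> s'" "s' \<le> b" "g s' = p"
    using IVT'[of g s p b] sab assms cs by auto
  have "g s = p" using above[of s'] s' by (cases "s = s'") auto
  obtain t where t: "s \<le> t" "t \<le> b" "g t = q"
    using IVT'[of g s q b] sab assms cs by auto
  show thesis
  proof
    show "p \<le> g x" if "x \<in> {s..t}" for x
      using above[of x] that t \<open>g s = p\<close> by (cases "x = s") auto
  qed (use sab t \<open>g s = p\<close> in auto)
qed

text \<open>\<open>continuous_crossing\<close> is applied a second time, to -g with time reversed on
  {s..t}; this keeps g below q without losing the lower bound p.\<close>

lemma continuous_crossing_band:
  fixes g :: "real \<Rightarrow> real"
  assumes cont: "continuous_on {a..b} g" and "a \<le> b" "g a \<le> p" "q \<le> g b" "p < q"
  obtains s t where "a \<le> s" "s \<le> t" "t \<le> b" "g s = p" "g t = q"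
    "\<And>x. x \<in> {s..t} \<Longrightarrow> g x \<in> {p..q}"
proof -
  obtain s t where st: "a \<le> s" "s \<le> t" "t \<le> b" "g s = p" "g t = q" "\<And>x. x \<in> {s..t} \<Longrightarrow> p \<le> g x"
    using continuous_crossing[OF assms] by blast
  have "continuous_on {s..t} (\<lambda>x. g (s + t - x))"
    by (rule continuous_on_compose2[OF cont continuous_on_diff[OF continuous_on_const continuous_on_id]])
       (use st in auto)
  then have "continuous_on {s..t} (\<lambda>x. - g (s + t - x))"
    by (rule continuous_on_minus)
  then obtain s' t' where st': "s \<le> s'" "s' \<le> t'" "t' \<le> t" "- g (s + t - s') = -q" "- g (s + t - t') = -p"
    "\<And>x. x \<in> {s'..t'} \<Longrightarrow> -q \<le> - g (s + t - x)"
    using continuous_crossing[of s t "\<lambda>x. - g (s + t - x)" "-q" "-p"] st assms(5) by auto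
  show thesis
  proof (rule that[of "s + t - t'" "s + t - s'"])
    fix x assume x: "x \<in> {s + t - t'..s + t - s'}"
    show "g x \<in> {p..q}"
      using st(6)[of x] st'(6)[of "s + t - x"] st'(1-3) x by auto
  qed (use st st' in auto)
qed

lemma length_ge_displacement:
  fixes \<gamma> :: "real \<Rightarrow> complex"
  assumes "valid_path \<gamma>" and ab: "0 \<le> a" "a \<le> b" "b \<le> 1" and "0 \<le> m"
    and int: "(\<lambda>t. \<rho> (\<gamma> t) * norm (vector_derivative \<gamma> (at t))) integrable_on {a..b}"
    and m: "\<And>t. t \<in> {a..b} \<Longrightarrow> m \<le> \<rho> (\<gamma> t)"
  shows "m * norm (\<gamma> b - \<gamma> a) \<le> integral {a..b} (\<lambda>t. \<rho> (\<gamma> t) * norm (vector_derivative \<gamma> (at t)))"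
proof -
  obtain S where S: "continuous_on {0..1} \<gamma>" "finite S" "\<gamma> C1_differentiable_on {0..1} - S"
    using assms(1) by (auto simp: valid_path_def piecewise_C1_differentiable_on_def)
  \<comment> \<open>This form of the fundamental theorem tolerates the finite set S, near which the
    derivative may be unbounded.\<close>
  have ftc: "((\<lambda>t. vector_derivative \<gamma> (at t)) has_integral (\<gamma> b - \<gamma> a)) {a..b}"
  proof (rule fundamental_theorem_of_calculus_interior_strong[OF S(2) ab(2)])
    show "continuous_on {a..b} \<gamma>"
      using S(1) by (rule continuous_on_subset) (use ab in auto)
    fix t assume "t \<in> {a<..<b} - S"
    then have "\<gamma> differentiable at t"
      using S(3) ab by (auto simp: C1_differentiable_on_eq)
    then show "(\<gamma> has_vector_derivative vector_derivative \<gamma> (at t)) (at t)"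
      by (simp add: vector_derivative_works)
  qed
  have "norm (integral {a..b} (\<lambda>t. m *\<^sub>R vector_derivative \<gamma> (at t)))
      \<le> integral {a..b} (\<lambda>t. \<rho> (\<gamma> t) * norm (vector_derivative \<gamma> (at t)))"
    using has_integral_cmul[OF ftc, of m]
    by (intro integral_norm_bound_integral[OF _ int] has_integral_integrable)
       (use m \<open>0 \<le> m\<close> in \<open>auto intro!: mult_right_mono\<close>)
  moreover have "integral {a..b} (\<lambda>t. m *\<^sub>R vector_derivative \<gamma> (at t)) = m *\<^sub>R (\<gamma> b - \<gamma> a)"
    by (rule integral_unique[OF has_integral_cmul[OF ftc]])
  ultimately show ?thesis
    using \<open>0 \<le> m\<close> by (simp only: norm_scaleR abs_of_nonneg)
qed

text \<open>Crossing the annulus between radii p n and q n costs at least b n, its width times the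
  lower bound of the density, and the costs of successive annuli add up. The end time T is variable
  so that the induction hypothesis can be applied at the moment when the path enters the outermost
  annulus.\<close>

lemma length_ge_sum_bands:
  fixes \<rho> :: "complex \<Rightarrow> real" and p q b :: "nat \<Rightarrow> real"
  assumes band: "\<And>n. p n < q n" "\<And>n. q n \<le> p (Suc n)" "\<And>n. 0 \<le> b n"
    and dens: "\<And>n z. p n \<le> norm z \<Longrightarrow> norm z \<le> q n \<Longrightarrow> b n / (q n - p n) \<le> \<rho> z"
    and \<gamma>: "valid_path \<gamma>" "norm (\<gamma> 0) \<le> p J" "path_image \<gamma> \<subseteq> D"
    and pos: "\<And>z. z \<in> D \<Longrightarrow> 0 \<le> \<rho> z"
    and int: "(\<lambda>t. \<rho> (\<gamma> t) * norm (vector_derivative \<gamma> (at t))) integrable_on {0..1}"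
    and T: "0 \<le> T" "T \<le> 1" "q (J + k) \<le> norm (\<gamma> T)"
  shows "(\<Sum>j\<le>k. b (J + j)) \<le> integral {0..T} (\<lambda>t. \<rho> (\<gamma> t) * norm (vector_derivative \<gamma> (at t)))"
  using T
proof (induction k arbitrary: T)
  let ?f = "\<lambda>t. \<rho> (\<gamma> t) * norm (vector_derivative \<gamma> (at t))"
  have intsub: "?f integrable_on {x..y}" if "0 \<le> x" "y \<le> 1" for x y
    using int by (rule integrable_on_subinterval) (use that in auto)
  have nn: "0 \<le> ?f t" if "0 \<le> t" "t \<le> 1" for t
    using pos[of "\<gamma> t"] \<gamma>(3) that by (force simp: path_image_def)
  have mono: "p J \<le> p (J + k)" for k
    by (induction k) (use band in \<open>auto intro: order_trans less_imp_le\<close>, meson band less_imp_le order_trans)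
  have cross: "\<exists>s t. 0 \<le> s \<and> s \<le> t \<and> t \<le> T \<and> norm (\<gamma> s) = p n \<and> norm (\<gamma> t) = q n
         \<and> b n \<le> integral {s..t} ?f"
    if T: "0 \<le> T" "T \<le> 1" "q n \<le> norm (\<gamma> T)" "norm (\<gamma> 0) \<le> p n" for T n
  proof -
    have "continuous_on {0..T} (\<lambda>t. norm (\<gamma> t))"
      using valid_path_imp_path[OF \<gamma>(1)] T unfolding path_def
      by (intro continuous_intros) (auto elim: continuous_on_subset)
    then obtain s t where st: "0 \<le> s" "s \<le> t" "t \<le> T" "norm (\<gamma> s) = p n" "norm (\<gamma> t) = q n"
      "\<And>x. x \<in> {s..t} \<Longrightarrow> norm (\<gamma> x) \<in> {p n..q n}"
      using continuous_crossing_band[of 0 T "\<lambda>t. norm (\<gamma> t)" "p n" "q n"] T band(1) by blast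
    have "b n = b n / (q n - p n) * (norm (\<gamma> t) - norm (\<gamma> s))"
      using band(1)[of n] st by simp
    also have "\<dots> \<le> b n / (q n - p n) * norm (\<gamma> t - \<gamma> s)"
      using band(1,3)[of n] by (intro mult_left_mono norm_triangle_ineq2) auto
    also have "\<dots> \<le> integral {s..t} ?f"
      using st T band(1,3)[of n] by (intro length_ge_displacement \<gamma> intsub) (auto intro!: dens)
    finally show ?thesis using st by blast
  qed
  {
    case 0
    then obtain s t where st: "0 \<le> s" "s \<le> t" "t \<le> T" "b J \<le> integral {s..t} ?f"
      using cross[of T J] \<gamma>(2) by auto
    have "integral {s..t} ?f \<le> integral {0..T} ?f"
      using st 0 nn by (intro integral_subset_le intsub) auto
    then show ?case using st by simp
  next
    case (Suc k)
    have "norm (\<gamma> 0) \<le> p (J + Suc k)" using \<gamma>(2) mono order_trans by blast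
    then obtain s t where st: "0 \<le> s" "s \<le> t" "t \<le> T" "norm (\<gamma> s) = p (J + Suc k)"
      "b (J + Suc k) \<le> integral {s..t} ?f"
      using cross[of T "J + Suc k"] Suc.prems by auto
    have "(\<Sum>j\<le>k. b (J + j)) \<le> integral {0..s} ?f"
      using st Suc.prems band(2)[of "J + k"] by (intro Suc.IH) auto
    moreover have "integral {0..s} ?f + integral {s..t} ?f = integral {0..t} ?f"
      using st Suc.prems by (intro Henstock_Kurzweil_Integration.integral_combine intsub) auto
    moreover have "integral {0..t} ?f \<le> integral {0..T} ?f"
      using st Suc.prems nn by (intro integral_subset_le intsub) auto
    ultimately show ?case using st by simp
  }
qed

section \<open>Divergent crossing costs imply completeness\<close>

lemma conformal_dist_le_segment:
  assumes D: "open D" "closed_segment x y \<subseteq> D" and cont: "continuous_on D \<rho>"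
    and pos: "\<And>z. z \<in> D \<Longrightarrow> 0 \<le> \<rho> z" and C: "\<And>z. z \<in> closed_segment x y \<Longrightarrow> \<rho> z \<le> C"
  shows "conformal_dist D \<rho> x y \<le> C * dist x y"
proof -
  define L where "L = integral {0..1} (\<lambda>t. \<rho> (linepath x y t) * norm (vector_derivative (linepath x y) (at t)))"
  have "continuous_on {0..1} (\<lambda>t. \<rho> (linepath x y t) * norm (y - x))"
    using D(2) by (intro continuous_intros continuous_on_compose2[OF cont])
       (auto simp flip: path_image_linepath simp: path_image_def)
  then have int: "(\<lambda>t. \<rho> (linepath x y t) * norm (vector_derivative (linepath x y) (at t))) integrable_on {0..1}"
    by (simp add: integrable_continuous_interval)
  then have len: "path_length_is \<rho> (linepath x y) L"
    unfolding path_length_is_def L_def by (rule integrable_integral)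
  have "L \<in> path_lengths D \<rho> x y"
    unfolding path_lengths_def using D len by (auto intro!: exI[of _ "linepath x y"])
  moreover have "bdd_below (path_lengths D \<rho> x y)"
    using path_length_is_nonneg pos unfolding path_lengths_def by (intro bdd_belowI[of _ 0]) blast
  ultimately have "Inf (path_lengths D \<rho> x y) \<le> L" by (rule cInf_lower)
  moreover have "L \<le> integral {0..1} (\<lambda>t::real. C * dist x y)"
    unfolding L_def
    by (rule integral_le[OF int])
       (auto simp: dist_norm norm_minus_commute intro!: mult_right_mono C linepath_in_path)
  moreover have "x \<in> D" "y \<in> D" using D(2) by auto
  ultimately show ?thesis by (simp add: conformal_dist_def)
qed

text \<open>As in the Hopf-Rinow theorem, bounded sets are relatively compact: since the costs b
  have unbounded partial sums, points at bounded distance from x have modulus bounded away from 1. A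
  Cauchy sequence therefore stays in a compact disc and has a convergent subsequence.\<close>

lemma complete_conformal_metric_bands:
  fixes \<rho> :: "complex \<Rightarrow> real" and p q b :: "nat \<Rightarrow> real"
  assumes cont: "continuous_on (ball 0 1) \<rho>" and pos: "\<And>z. z \<in> ball 0 1 \<Longrightarrow> 0 < \<rho> z"
    and band: "\<And>n. p n < q n" "\<And>n. q n \<le> p (Suc n)" "\<And>n. q n < 1" "\<And>n. 0 \<le> b n"
    and dens: "\<And>n z. p n \<le> norm z \<Longrightarrow> norm z \<le> q n \<Longrightarrow> b n / (q n - p n) \<le> \<rho> z"
    and exhaust: "\<And>r. r < 1 \<Longrightarrow> \<exists>n. r \<le> p n"
    and div: "\<not> summable b"
  shows "complete_conformal_metric (ball 0 1) \<rho>"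
proof -
  let ?D = "ball 0 1 :: complex set"
  let ?d = "conformal_dist ?D \<rho>"
  interpret Metric_space ?D ?d
    using Metric_space_conformal_dist[of ?D \<rho>] cont pos by auto
  have far: "\<exists>r<1. \<forall>y\<in>?D. ?d x y \<le> B \<longrightarrow> norm y \<le> r" if x: "x \<in> ?D" for x B
  proof -
    obtain J where J: "norm x \<le> p J" using exhaust[of "norm x"] x by auto
    have "\<not> summable (\<lambda>j. b (J + j))"
      using div summable_iff_shift[of b J] by (simp add: add.commute)
    then have "\<not> (\<forall>k. (\<Sum>j\<le>k. b (J + j)) \<le> B)"
      using bounded_imp_summable[of "\<lambda>j. b (J + j)" B] band(4) by blast
    then obtain k where k: "B < (\<Sum>j\<le>k. b (J + j))"
      using not_le by blast
    have "norm y < q (J + k)" if y: "y \<in> ?D" "?d x y \<le> B" for y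
    proof (rule ccontr)
      assume "\<not> norm y < q (J + k)"
      have "(\<Sum>j\<le>k. b (J + j)) \<le> L" if L: "L \<in> path_lengths ?D \<rho> x y" for L
      proof -
        obtain \<gamma> where \<gamma>: "valid_path \<gamma>" "path_image \<gamma> \<subseteq> ?D" "\<gamma> 0 = x" "\<gamma> 1 = y"
          "path_length_is \<rho> \<gamma> L"
          using L by (auto simp: path_lengths_def pathstart_def pathfinish_def)
        have "(\<Sum>j\<le>k. b (J + j)) \<le> integral {0..1} (\<lambda>t. \<rho> (\<gamma> t) * norm (vector_derivative \<gamma> (at t)))"
          by (rule length_ge_sum_bands[where p = p and q = q and D = ?D])
             (use \<gamma> J band dens pos \<open>\<not> norm y < q (J + k)\<close> in
              \<open>auto simp: path_length_is_def less_imp_le intro: has_integral_integrable\<close>)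
        then show ?thesis using \<gamma>(5) by (simp add: path_length_is_def integral_unique)
      qed
      then have "(\<Sum>j\<le>k. b (J + j)) \<le> ?d x y"
        using path_lengths_nonempty[of ?D \<rho> x y] cont x y
        by (auto simp: conformal_dist_def intro!: cInf_greatest)
      then show False using k y by simp
    qed
    then show ?thesis using band(3)[of "J + k"] less_imp_le by blast
  qed
  have "\<exists>x. limitin mtopology \<sigma> x sequentially" if \<sigma>: "MCauchy \<sigma>" for \<sigma>
  proof -
    have \<sigma>D: "\<sigma> n \<in> ?D" for n using \<sigma> unfolding MCauchy_def by blast
    obtain N where N: "\<And>n. N \<le> n \<Longrightarrow> ?d (\<sigma> N) (\<sigma> n) < 1"
      using \<sigma> unfolding MCauchy_def by (meson order_refl zero_less_one)
    obtain r where r: "r < 1" "\<And>n. N \<le> n \<Longrightarrow> norm (\<sigma> n) \<le> r"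
      using far[OF \<sigma>D[of N], of 1] N \<sigma>D less_imp_le by meson
    have "compact (cball (0::complex) r)" by simp
    moreover have "\<forall>n. \<sigma> (N + n) \<in> cball 0 r" using r by simp
    ultimately obtain l k where l: "l \<in> cball 0 r" "strict_mono (k :: nat \<Rightarrow> nat)"
        "(\<lambda>n. \<sigma> (N + k n)) \<longlonglongrightarrow> l"
      using compact_imp_seq_compact[unfolded seq_compact_def, of "cball (0::complex) r"]
      by (fastforce simp: o_def)
    have lD: "l \<in> ?D" using l r by auto
    have sub: "cball 0 r \<subseteq> ?D" using r by auto
    obtain C where C: "\<And>z. z \<in> cball 0 r \<Longrightarrow> \<rho> z \<le> C"
      using continuous_attains_sup[of "cball (0::complex) r" \<rho>] continuous_on_subset[OF cont sub] l
      by (metis compact_cball empty_iff)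
    \<comment> \<open>Segments between points of the compact disc stay in it, so the bound C on the
      density turns Euclidean convergence into convergence for
      \<open>conformal_dist\<close>.\<close>
    have dle: "?d (\<sigma> (N + k n)) l \<le> C * dist (\<sigma> (N + k n)) l" for n
    proof (rule conformal_dist_le_segment)
      have "closed_segment (\<sigma> (N + k n)) l \<subseteq> cball 0 r"
        using l r by (intro closed_segment_subset) auto
      then show "closed_segment (\<sigma> (N + k n)) l \<subseteq> ?D"
        "\<And>z. z \<in> closed_segment (\<sigma> (N + k n)) l \<Longrightarrow> \<rho> z \<le> C"
        using sub C by auto
    qed (use cont pos less_imp_le in auto)
    have "(\<lambda>n. C * dist (\<sigma> (N + k n)) l) \<longlonglongrightarrow> C * 0"
      using l(3) by (intro tendsto_intros) (simp add: tendsto_dist_iff[symmetric])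
    then have lim: "(\<lambda>n. ?d (\<sigma> (N + k n)) l) \<longlonglongrightarrow> 0"
      by (intro tendsto_sandwich[OF _ _ tendsto_const, of 0 "\<lambda>n. ?d (\<sigma> (N + k n)) l" sequentially
            "\<lambda>n. C * dist (\<sigma> (N + k n)) l"])
         (use dle in auto)
    have "limitin mtopology (\<sigma> \<circ> (\<lambda>n. N + k n)) l sequentially"
      unfolding limit_metric_sequentially
    proof (intro conjI allI impI lD)
      fix e :: real assume "0 < e"
      then show "\<exists>M. \<forall>n\<ge>M. (\<sigma> \<circ> (\<lambda>n. N + k n)) n \<in> ?D \<and> ?d ((\<sigma> \<circ> (\<lambda>n. N + k n)) n) l < e"
        using order_tendstoD(2)[OF lim] \<sigma>D by (auto simp: eventually_sequentially)
    qed
    moreover have "strict_mono (\<lambda>n. N + k n)"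
      using l(2) by (auto simp: strict_mono_def)
    ultimately show ?thesis
      using MCauchy_convergent_subsequence[OF \<sigma>] by blast
  qed
  then show ?thesis
    using Metric_space_axioms by (auto simp: complete_conformal_metric_def mcomplete_def)
qed

section \<open>The almost invariant function\<close>

text \<open>Put R = |u|^2 + |v|^2 and x = R - 1. On ds = v du - u dv the complex differential of Phi
  becomes Q du - P dv with P = cnj s * u - 2 x cnj v and Q = cnj s * v + 2 x cnj u. Its kernel is
  spanned by (P, Q), for which ds = - 2 x R.\<close>

definition Phi :: "complex \<Rightarrow> complex \<Rightarrow> complex \<Rightarrow> real" where
  "Phi u v s = ((cmod u)\<^sup>2 + (cmod v)\<^sup>2 - 1)\<^sup>2 + (cmod s)\<^sup>2"

text \<open>The displacement of \<open>(u, v)\<close> spans the kernel of the complex differential of \<open>Phi\<close> on the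
  contact plane \<open>ds = v du - u dv\<close>, so there is no term linear in \<open>w\<close>.\<close>

lemma Phi_step_eq:
  fixes u v s w :: complex
  defines "R \<equiv> (cmod u)\<^sup>2 + (cmod v)\<^sup>2"
  defines "x \<equiv> R - 1"
  defines "\<delta> \<equiv> 2 * R * Re (w * cnj s)"
  defines "e \<equiv> R * (cmod w)\<^sup>2 * ((cmod s)\<^sup>2 + 4 * x\<^sup>2)"
  shows "Phi (u + w * (cnj s * u - 2 * of_real x * cnj v)) (v + w * (cnj s * v + 2 * of_real x * cnj u))
           (s - 2 * of_real x * of_real R * w)
         = Phi u v s + (\<delta>\<^sup>2 + 2 * (x + \<delta>) * e + e\<^sup>2 + 4 * x\<^sup>2 * R\<^sup>2 * (cmod w)\<^sup>2)"
proof -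
  have 1: "(cmod (u + w * (cnj s * u - 2 * of_real y * cnj v)))\<^sup>2 + (cmod (v + w * (cnj s * v + 2 * of_real y * cnj u)))\<^sup>2
      = R + 2 * R * Re (w * cnj s) + R * (cmod w)\<^sup>2 * ((cmod s)\<^sup>2 + 4 * y\<^sup>2)" for y
    unfolding R_def cmod_power2 by (simp add: power2_eq_square algebra_simps)
  have 2: "(cmod (s - 2 * of_real y * of_real Q * w))\<^sup>2
      = (cmod s)\<^sup>2 - 4 * y * Q * Re (w * cnj s) + 4 * y\<^sup>2 * Q\<^sup>2 * (cmod w)\<^sup>2" for y Q
    unfolding cmod_power2 by (simp add: power2_eq_square algebra_simps)
  have 3: "Phi u v s = x\<^sup>2 + (cmod s)\<^sup>2" by (simp add: Phi_def x_def R_def)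
  have 4: "R + \<delta> + e - 1 = x + \<delta> + e" by (simp add: x_def)
  show ?thesis
    unfolding Phi_def[of "u + _"] 1 2 3
    unfolding \<delta>_def[symmetric] e_def[symmetric] 4
    by (simp add: \<delta>_def power2_eq_square algebra_simps)
qed

text \<open>The bound 5/8 comes from 3/8 < (5/8)^2; being below 1, it keeps (u, v) away from the
  origin. The coarse bounds by 2 are those that the maximum principle later carries into the
  disc.\<close>

lemma Phi_bounds:
  assumes "Phi u v s \<le> 3/8"
  shows "\<bar>(cmod u)\<^sup>2 + (cmod v)\<^sup>2 - 1\<bar> \<le> 5/8" "(cmod s)\<^sup>2 \<le> 3/8"
    "cmod u \<le> 2" "cmod v \<le> 2" "cmod s \<le> 2"
proof -
  let ?x = "(cmod u)\<^sup>2 + (cmod v)\<^sup>2 - 1"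
  have "?x\<^sup>2 + (cmod s)\<^sup>2 \<le> 3/8" using assms by (simp add: Phi_def)
  then have x: "?x\<^sup>2 \<le> 3/8" and s: "(cmod s)\<^sup>2 \<le> 3/8"
    by (smt (verit) zero_le_power2)+
  have "?x\<^sup>2 \<le> (5/8)\<^sup>2" using x by (simp add: power2_eq_square)
  then show bx: "\<bar>?x\<bar> \<le> 5/8" using abs_le_square_iff[of ?x "5/8"] by simp
  show "(cmod s)\<^sup>2 \<le> 3/8" by (fact s)
  have "?x \<le> 5/8" using bx by (simp only: abs_le_iff)
  then have "(cmod u)\<^sup>2 \<le> 4" "(cmod v)\<^sup>2 \<le> 4" "(cmod s)\<^sup>2 \<le> 4"
    using s zero_le_power2[of "cmod u"] zero_le_power2[of "cmod v"] by linarith+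
  then have "(cmod u)\<^sup>2 \<le> 2\<^sup>2" "(cmod v)\<^sup>2 \<le> 2\<^sup>2" "(cmod s)\<^sup>2 \<le> 2\<^sup>2"
    by simp_all
  then show "cmod u \<le> 2" "cmod v \<le> 2" "cmod s \<le> 2"
    using power2_le_imp_le by (metis zero_le_numeral)+
qed

text \<open>Only terms of second order in w remain in \<open>Phi_step_eq\<close>. By
  \<open>Phi_bounds\<close> they are at most 5, 24, 16 and 5 times |w|^2, so 80 leaves
  slack.\<close>

lemma Phi_step_le:
  fixes u v s w :: complex
  defines "R \<equiv> (cmod u)\<^sup>2 + (cmod v)\<^sup>2"
  defines "x \<equiv> R - 1"
  assumes "Phi u v s \<le> 3/8" "cmod w \<le> 1"
  shows "\<bar>Phi (u + w * (cnj s * u - 2 * of_real x * cnj v)) (v + w * (cnj s * v + 2 * of_real x * cnj u))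
           (s - 2 * of_real x * of_real R * w) - Phi u v s\<bar> \<le> 80 * (cmod w)\<^sup>2"
proof -
  define a where "a = cmod w"
  define \<delta> where "\<delta> = 2 * R * Re (w * cnj s)"
  define e where "e = R * (cmod w)\<^sup>2 * ((cmod s)\<^sup>2 + 4 * x\<^sup>2)"
  have a: "0 \<le> a" "a \<le> 1" using assms by (auto simp: a_def)
  have x: "\<bar>x\<bar> \<le> 5/8" and s: "(cmod s)\<^sup>2 \<le> 3/8"
    using Phi_bounds[OF assms(3)] by (auto simp: x_def R_def)
  have R: "0 \<le> R" by (simp add: R_def)
  have "x \<le> 5/8" using x by (simp only: abs_le_iff)
  then have R: "0 \<le> R" "R \<le> 13/8" using R by (simp_all add: x_def)
  have x2: "x\<^sup>2 \<le> 25/64"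
    using power_mono[OF x, of 2] by (simp add: power2_eq_square)
  have "(cmod s)\<^sup>2 \<le> (5/8)\<^sup>2" using s by (simp add: power2_eq_square)
  then have s': "cmod s \<le> 5/8" using power2_le_imp_le[of "cmod s" "5/8"] by simp
  have "\<bar>Re (w * cnj s)\<bar> \<le> a * cmod s"
    using abs_Re_le_cmod[of "w * cnj s"] by (simp add: norm_mult a_def)
  also have "\<dots> \<le> a * (5/8)" using s' a by (intro mult_left_mono) auto
  finally have "2 * R * \<bar>Re (w * cnj s)\<bar> \<le> 2 * R * (a * (5/8))"
    using R by (intro mult_left_mono) auto
  then have "\<bar>\<delta>\<bar> \<le> 2 * R * (a * (5/8))"
    unfolding \<delta>_def abs_mult using R by simp
  also have "\<dots> \<le> 2 * (13/8) * (a * (5/8))" using R a by (intro mult_mono) auto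
  finally have d: "\<bar>\<delta>\<bar> \<le> 65/32 * a" by simp
  have a2: "a\<^sup>2 \<le> 1" using a by (simp add: power_le_one)
  have e0: "0 \<le> e" using R by (auto simp: e_def)
  have "e \<le> 13/8 * a\<^sup>2 * (3/8 + 4 * (25/64))"
    unfolding e_def a_def[symmetric] using R x2 s by (intro mult_mono) auto
  also have "\<dots> = 403/128 * a\<^sup>2" by simp
  finally have e: "e \<le> 4 * a\<^sup>2" using zero_le_power2[of a] by linarith
  have d2: "\<delta>\<^sup>2 \<le> 5 * a\<^sup>2"
  proof -
    have "\<delta>\<^sup>2 = \<bar>\<delta>\<bar> * \<bar>\<delta>\<bar>" by (simp add: power2_eq_square)
    also have "\<dots> \<le> (65/32 * a) * (65/32 * a)" using d a by (intro mult_mono) auto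
    also have "\<dots> = 4225/1024 * a\<^sup>2" by (simp add: power2_eq_square)
    also have "\<dots> \<le> 5 * a\<^sup>2" by (intro mult_right_mono) auto
    finally show ?thesis .
  qed
  have "\<bar>2 * (x + \<delta>) * e\<bar> \<le> 2 * 3 * (4 * a\<^sup>2)"
    unfolding abs_mult using x d a e e0 by (intro mult_mono) auto
  moreover have "e\<^sup>2 \<le> 16 * a\<^sup>2"
  proof -
    have "e * e \<le> 4 * (4 * a\<^sup>2)" using e e0 a2 by (intro mult_mono) auto
    then show ?thesis by (simp add: power2_eq_square)
  qed
  moreover have "4 * x\<^sup>2 * R\<^sup>2 * a\<^sup>2 \<le> 5 * a\<^sup>2"
  proof -
    have "4 * x\<^sup>2 * R\<^sup>2 \<le> 4 * (25/64) * (13/8)\<^sup>2"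
      using x2 R by (intro mult_mono power_mono) auto
    also have "\<dots> \<le> 5" by (simp add: power2_eq_square)
    finally show ?thesis by (intro mult_right_mono) auto
  qed
  moreover have "0 \<le> 4 * x\<^sup>2 * R\<^sup>2 * a\<^sup>2" by simp
  moreover have "0 \<le> \<delta>\<^sup>2" "0 \<le> e\<^sup>2" by simp_all
  ultimately have "\<bar>\<delta>\<^sup>2 + 2 * (x + \<delta>) * e + e\<^sup>2 + 4 * x\<^sup>2 * R\<^sup>2 * a\<^sup>2\<bar> \<le> 80 * a\<^sup>2"
    using d2 by linarith
  then show ?thesis
    unfolding Phi_step_eq[of u w s v, folded R_def, folded x_def, folded \<delta>_def e_def] a_def
    by (simp only: add_diff_cancel_left')
qed

lemma cmod_power2_diff_le:
  assumes "cmod u \<le> 10" "cmod p \<le> \<epsilon>" "\<epsilon> \<le> 1"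
  shows "\<bar>(cmod (u + p))\<^sup>2 - (cmod u)\<^sup>2\<bar> \<le> 21 * \<epsilon>"
proof -
  have d: "\<bar>cmod (u + p) - cmod u\<bar> \<le> \<epsilon>"
    using norm_triangle_ineq3[of "u + p" u] assms by simp
  have "(cmod (u + p))\<^sup>2 - (cmod u)\<^sup>2 = (cmod (u + p) - cmod u) * (cmod (u + p) + cmod u)"
    by (simp add: power2_eq_square algebra_simps)
  then have "\<bar>(cmod (u + p))\<^sup>2 - (cmod u)\<^sup>2\<bar> = \<bar>cmod (u + p) - cmod u\<bar> * (cmod (u + p) + cmod u)"
    by (simp add: abs_mult)
  also have "\<dots> \<le> \<epsilon> * 21"
    using d assms norm_triangle_ineq[of u p] by (intro mult_mono) auto
  finally show ?thesis by simp
qed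

text \<open>For an error without a special direction the change of Phi is of first order, so such
  errors have to be far smaller than a^2. This serves for the correction of the third coordinate and
  for the generic perturbation.\<close>

lemma Phi_perturb:
  assumes "cmod u \<le> 9" "cmod v \<le> 9" "cmod s \<le> 9"
    and "cmod p \<le> \<epsilon>" "cmod q \<le> \<epsilon>" "cmod r \<le> \<epsilon>" "\<epsilon> \<le> 1"
  shows "\<bar>Phi (u + p) (v + q) (s + r) - Phi u v s\<bar> \<le> 20000 * \<epsilon>"
proof -
  define x y where "x = (cmod u)\<^sup>2 + (cmod v)\<^sup>2 - 1"
    and "y = (cmod (u + p))\<^sup>2 + (cmod (v + q))\<^sup>2 - 1"
  have xy: "\<bar>y - x\<bar> \<le> 42 * \<epsilon>" and s: "\<bar>(cmod (s + r))\<^sup>2 - (cmod s)\<^sup>2\<bar> \<le> 21 * \<epsilon>"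
    using cmod_power2_diff_le[of u p \<epsilon>] cmod_power2_diff_le[of v q \<epsilon>] cmod_power2_diff_le[of s r \<epsilon>] assms
    by (auto simp: x_def y_def)
  have "(cmod u)\<^sup>2 \<le> 81" "(cmod v)\<^sup>2 \<le> 81"
    using power_mono[OF assms(1), of 2] power_mono[OF assms(2), of 2] by auto
  then have "\<bar>x\<bar> \<le> 161"
    unfolding x_def by (smt (verit) zero_le_power2)
  moreover have "0 \<le> \<epsilon>" using assms(4) norm_ge_zero order_trans by blast
  \<comment> \<open>364 = 2 * 161 + 42 bounds |y + x|.\<close>
  ultimately have "\<bar>y - x\<bar> * \<bar>y + x\<bar> \<le> (42 * \<epsilon>) * 364"
    using xy assms(7) by (intro mult_mono) auto
  then have "\<bar>y\<^sup>2 - x\<^sup>2\<bar> \<le> 15288 * \<epsilon>"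
    by (simp add: power2_eq_square square_diff_square_factored abs_mult mult.commute)
  then show ?thesis
    using s \<open>0 \<le> \<epsilon>\<close> unfolding Phi_def x_def[symmetric] y_def[symmetric] by linarith
qed

text \<open>The squared length of the direction is R (4 x^2 + |s|^2). Here R \<ge> 3/8 because |x|
  \<le> 5/8, and the second factor is at least Phi \<ge> 1/8; the product 3/64 exceeds
  (1/5)^2.\<close>

lemma step_direction_ge:
  fixes u v s :: complex
  defines "x \<equiv> (cmod u)\<^sup>2 + (cmod v)\<^sup>2 - 1"
  assumes "1/8 \<le> Phi u v s" "Phi u v s \<le> 3/8"
  shows "1/5 \<le> cmod (cnj s * u - 2 * of_real x * cnj v) + cmod (cnj s * v + 2 * of_real x * cnj u)"
proof -
  define P Q where "P = cnj s * u - 2 * of_real x * cnj v" and "Q = cnj s * v + 2 * of_real x * cnj u"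
  have "(cmod (cnj s * u - 2 * of_real y * cnj v))\<^sup>2 + (cmod (cnj s * v + 2 * of_real y * cnj u))\<^sup>2
       = ((cmod u)\<^sup>2 + (cmod v)\<^sup>2) * (4 * y\<^sup>2 + (cmod s)\<^sup>2)" for y
    unfolding cmod_power2 by (simp add: power2_eq_square algebra_simps)
  then have eq: "(cmod P)\<^sup>2 + (cmod Q)\<^sup>2 = ((cmod u)\<^sup>2 + (cmod v)\<^sup>2) * (4 * x\<^sup>2 + (cmod s)\<^sup>2)"
    by (simp add: P_def Q_def)
  have x: "\<bar>x\<bar> \<le> 5/8" using Phi_bounds[OF assms(3)] by (simp add: x_def)
  then have "- x \<le> 5/8" by (simp only: abs_le_iff)
  then have R: "3/8 \<le> (cmod u)\<^sup>2 + (cmod v)\<^sup>2" by (simp add: x_def)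
  have "1/8 \<le> 4 * x\<^sup>2 + (cmod s)\<^sup>2"
    using assms(2) unfolding Phi_def x_def[symmetric] by (smt (verit) zero_le_power2)
  then have "3/8 * (1/8) \<le> (cmod P)\<^sup>2 + (cmod Q)\<^sup>2"
    unfolding eq using R by (intro mult_mono) auto
  moreover have "0 \<le> cmod P * cmod Q" by simp
  moreover have "(cmod P + cmod Q)\<^sup>2 = (cmod P)\<^sup>2 + (cmod Q)\<^sup>2 + 2 * (cmod P * cmod Q)"
    by (simp add: power2_eq_square algebra_simps)
  moreover have "(1/5)\<^sup>2 \<le> (3/64 :: real)" by (simp add: power2_eq_square)
  ultimately have "(1/5)\<^sup>2 \<le> (cmod P + cmod Q)\<^sup>2"
    by linarith
  then have "1/5 \<le> cmod P + cmod Q"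
    by (rule power2_le_imp_le) auto
  then show ?thesis by (simp add: P_def Q_def)
qed

section \<open>Laurent polynomials on the circle\<close>

text \<open>Only values on the circle enter, and the pole at 0 is cleared by z^d. In this way
  expressions with conjugates qualify although they are not holomorphic.\<close>

definition laurent :: "(complex \<Rightarrow> complex) \<Rightarrow> bool" where
  "laurent f \<longleftrightarrow> (\<exists>d p. \<forall>z. cmod z = 1 \<longrightarrow> z ^ d * f z = poly p z)"

lemma laurent_poly: "laurent (poly p)"
  unfolding laurent_def by (intro exI[of _ 0] exI[of _ p]) simp

lemma laurent_const: "laurent (\<lambda>z. c)"
  unfolding laurent_def by (intro exI[of _ 0] exI[of _ "[:c:]"]) simp

lemma laurent_common:
  assumes "laurent f" "laurent g"
  obtains d p q where "\<And>z. cmod z = 1 \<Longrightarrow> z ^ d * f z = poly p z" "\<And>z. cmod z = 1 \<Longrightarrow> z ^ d * g z = poly q z"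
proof -
  obtain d p where 1: "\<And>z. cmod z = 1 \<Longrightarrow> z ^ d * f z = poly p z" using assms(1) by (auto simp: laurent_def)
  obtain e q where 2: "\<And>z. cmod z = 1 \<Longrightarrow> z ^ e * g z = poly q z" using assms(2) by (auto simp: laurent_def)
  show thesis
  proof (rule that[of "d + e" "monom 1 e * p" "monom 1 d * q"])
    fix z :: complex assume z: "cmod z = 1"
    show "z ^ (d + e) * f z = poly (monom 1 e * p) z"
      using 1[OF z, symmetric] by (simp add: poly_monom power_add)
    show "z ^ (d + e) * g z = poly (monom 1 d * q) z"
      using 2[OF z, symmetric] by (simp add: poly_monom power_add)
  qed
qed

lemma laurent_add:
  assumes "laurent f" "laurent g"
  shows "laurent (\<lambda>z. f z + g z)"
proof -
  obtain d p q where "\<And>z. cmod z = 1 \<Longrightarrow> z ^ d * f z = poly p z" "\<And>z. cmod z = 1 \<Longrightarrow> z ^ d * g z = poly q z"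
    using laurent_common[OF assms] by blast
  then show ?thesis
    unfolding laurent_def by (intro exI[of _ d] exI[of _ "p + q"]) (simp add: algebra_simps)
qed

lemma laurent_mult:
  assumes "laurent f" "laurent g"
  shows "laurent (\<lambda>z. f z * g z)"
proof -
  obtain d p q where dpq: "\<And>z. cmod z = 1 \<Longrightarrow> z ^ d * f z = poly p z" "\<And>z. cmod z = 1 \<Longrightarrow> z ^ d * g z = poly q z"
    using laurent_common[OF assms] by blast
  show ?thesis
    unfolding laurent_def
    by (intro exI[of _ "d + d"] exI[of _ "p * q"]) (simp add: dpq[symmetric] power_add)
qed

lemma laurent_cnj_poly: "laurent (\<lambda>z. cnj (poly p z))"
proof (induction p)
  case 0
  then show ?case using laurent_const[of 0] by simp
next
  case (pCons a p)
  \<comment> \<open>On the circle z * \<open>cnj z\<close> = 1, so conjugation is a Laurent monomial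
    there.\<close>
  have "laurent cnj"
    unfolding laurent_def
    by (intro exI[of _ 1] exI[of _ 1]) (simp add: complex_norm_square[symmetric])
  then show ?case
    using laurent_add[OF laurent_const laurent_mult[OF _ pCons.IH], of cnj "cnj a"] by simp
qed

lemmas laurent_intros = laurent_poly laurent_const laurent_add laurent_mult laurent_cnj_poly

section \<open>Polynomial Legendrian curves\<close>

text \<open>Termwise integration of z^n G divides every coefficient by at least n + 1, so C can be
  the sum of the moduli of the coefficients of G. This is why a fast oscillation hardly disturbs the
  third coordinate. The case n = 0 also supplies plain primitives.\<close>

lemma poly_primitive_monom:
  fixes G :: "complex poly"
  shows "\<exists>C. \<forall>n. \<exists>H. pderiv H = monom 1 n * G \<and> (\<forall>z. cmod z \<le> 1 \<longrightarrow> cmod (poly H z) \<le> C / (real n + 1))"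
proof (induction G)
  case 0
  show ?case by (intro exI[of _ 0] allI exI[of _ 0]) simp
next
  case (pCons a G)
  obtain C where C: "\<And>n. \<exists>H. pderiv H = monom 1 n * G \<and> (\<forall>z. cmod z \<le> 1 \<longrightarrow> cmod (poly H z) \<le> C / (real n + 1))"
    using pCons.IH by blast
  obtain H0 where H0: "\<And>z. cmod z \<le> 1 \<Longrightarrow> cmod (poly H0 z) \<le> C / (0 + 1)"
    using C[of 0] by auto
  \<comment> \<open>Nonnegativity allows the denominator n + 2 to be replaced by n + 1
    below.\<close>
  have "0 \<le> C" using order_trans[OF norm_ge_zero H0[of 0]] by simp
  show ?case
  proof (intro exI[of _ "cmod a + C"] allI)
    fix n
    obtain H where "pderiv H = monom 1 (Suc n) * G \<and> (\<forall>z. cmod z \<le> 1 \<longrightarrow> cmod (poly H z) \<le> C / (real (Suc n) + 1))"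
      using C[of "Suc n"] by (rule exE)
    then have H: "pderiv H = monom 1 (Suc n) * G" "cmod z \<le> 1 \<Longrightarrow> cmod (poly H z) \<le> C / (real (Suc n) + 1)" for z
      by simp_all
    define K where "K = monom (a / of_nat (Suc n)) (Suc n) + H"
    have "pderiv K = monom a n + monom 1 (Suc n) * G"
      unfolding K_def pderiv_add H(1) pderiv_monom by (simp del: of_nat_Suc)
    also have "\<dots> = monom 1 n * pCons a G"
      by (rule poly_ext)
         (simp add: poly_monom algebra_simps)
    finally have "pderiv K = monom 1 n * pCons a G" .
    moreover have "cmod (poly K z) \<le> (cmod a + C) / (real n + 1)" if z: "cmod z \<le> 1" for z
    proof -
      have "cmod (poly K z) \<le> cmod (a / of_nat (Suc n) * z ^ Suc n) + cmod (poly H z)"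
        unfolding K_def poly_add poly_monom by (rule norm_triangle_ineq)
      also have "cmod (a / of_nat (Suc n) * z ^ Suc n) \<le> cmod a / real (Suc n) * 1"
        unfolding norm_mult norm_divide norm_power norm_of_nat using z
        by (intro mult_left_mono power_le_one) auto
      also have "cmod (poly H z) \<le> C / real (Suc n)"
        by (rule order_trans[OF H(2)[OF z]]) (use \<open>0 \<le> C\<close> in \<open>intro divide_left_mono; simp\<close>)
      finally show ?thesis by (simp add: add_divide_distrib add.commute)
    qed
    ultimately show "\<exists>H. pderiv H = monom 1 n * pCons a G \<and>
        (\<forall>z. cmod z \<le> 1 \<longrightarrow> cmod (poly H z) \<le> (cmod a + C) / (real n + 1))" by blast
  qed
qed

lemma poly_bounded_disc:
  fixes p :: "complex poly"
  obtains C where "0 < C" "\<And>z. cmod z \<le> 1 \<Longrightarrow> cmod (poly p z) \<le> C"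
proof -
  have "compact (poly p ` cball 0 1)"
    by (intro compact_continuous_image continuous_intros) simp
  then obtain C where "0 < C" "\<forall>x\<in>poly p ` cball 0 1. cmod x \<le> C"
    using compact_imp_bounded bounded_pos by metis
  then show thesis using that by auto
qed

definition legendrian_poly :: "complex poly \<Rightarrow> complex poly \<Rightarrow> complex poly \<Rightarrow> bool" where
  "legendrian_poly u v s \<longleftrightarrow> pderiv s = v * pderiv u - u * pderiv v"

text \<open>Adding c z to u and d z to v shifts the derivatives by constants. Once d makes
  \<open>pderiv v + [:d:]\<close> a nonzero polynomial, it has finitely many roots and c has only
  finitely many values to avoid. This removes the common zeros of the derivatives, at which the
  immersion would fail.\<close>

lemma legendrian_poly_generic:
  assumes "legendrian_poly u v s" "0 < \<epsilon>"
  obtains u' v' s' where "legendrian_poly u' v' s'"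
    "\<And>z. poly (pderiv u') z \<noteq> 0 \<or> poly (pderiv v') z \<noteq> 0"
    "\<And>z. cmod z \<le> 1 \<Longrightarrow> cmod (poly u' z - poly u z) \<le> \<epsilon>"
    "\<And>z. cmod z \<le> 1 \<Longrightarrow> cmod (poly v' z - poly v z) \<le> \<epsilon>"
    "\<And>z. cmod z \<le> 1 \<Longrightarrow> cmod (poly s' z - poly s z) \<le> \<epsilon>"
    "\<And>z. cmod (poly (pderiv u') z - poly (pderiv u) z) \<le> \<epsilon>"
    "\<And>z. cmod (poly (pderiv v') z - poly (pderiv v) z) \<le> \<epsilon>"
proof -
  \<comment> \<open>In (v + d z) (u + c z)' - (u + c z) (v + d z)' the terms with c d cancel, so c S
    + d T is the exact correction of s.\<close>
  obtain S where S: "pderiv S = v - monom 1 1 * pderiv v"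
    using poly_primitive_monom[of "v - monom 1 1 * pderiv v"] by (metis monom_0 one_pCons mult_1)
  obtain T where T: "pderiv T = monom 1 1 * pderiv u - u"
    using poly_primitive_monom[of "monom 1 1 * pderiv u - u"] by (metis monom_0 one_pCons mult_1)
  obtain C where C: "0 < C" "\<And>z. cmod z \<le> 1 \<Longrightarrow> cmod (poly S z) \<le> C" using poly_bounded_disc by blast
  obtain C' where C': "0 < C'" "\<And>z. cmod z \<le> 1 \<Longrightarrow> cmod (poly T z) \<le> C'" using poly_bounded_disc by blast
  define \<eta> where "\<eta> = min \<epsilon> (\<epsilon> / (C + C'))"
  have \<eta>: "0 < \<eta>" "\<eta> \<le> \<epsilon>" "\<eta> * (C + C') \<le> \<epsilon>"
  proof -
    have "\<eta> * (C + C') \<le> \<epsilon> / (C + C') * (C + C')"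
      using C(1) C'(1) by (intro mult_right_mono) (auto simp: \<eta>_def)
    then show "0 < \<eta>" "\<eta> \<le> \<epsilon>" "\<eta> * (C + C') \<le> \<epsilon>"
      using assms(2) C(1) C'(1) by (auto simp: \<eta>_def)
  qed
  obtain d where d: "cmod d \<le> \<eta>" "pderiv v + [:d:] \<noteq> 0"
  proof (cases "pderiv v = 0")
    case True
    then show thesis using that[of "of_real \<eta>"] \<eta> by auto
  next
    case False
    then show thesis using that[of 0] \<eta> by auto
  qed
  have "finite {z. poly (pderiv v + [:d:]) z = 0}" using d(2) by (rule poly_roots_finite)
  then have "finite ((\<lambda>z. - poly (pderiv u) z) ` {z. poly (pderiv v + [:d:]) z = 0})" by blast
  moreover have "infinite (ball (0::complex) \<eta>)"
    using \<eta> uncountable_ball[of \<eta> 0] countable_finite by blast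
  ultimately obtain c where c: "c \<in> ball 0 \<eta>" "c \<notin> (\<lambda>z. - poly (pderiv u) z) ` {z. poly (pderiv v + [:d:]) z = 0}"
    by (meson finite_subset subsetI)
  have c\<eta>: "cmod c \<le> \<eta>" using c by simp
  have bd: "cmod (b * x) \<le> \<epsilon>" if "cmod b \<le> \<eta>" "cmod x \<le> 1" for b x
    using mult_mono[OF that(1) that(2)] \<eta> by (simp add: norm_mult)
  show thesis
  proof (rule that[of "u + monom c 1" "v + monom d 1" "s + smult c S + smult d T"])
    have "pderiv (monom a 1) = [:a:]" for a :: complex by (simp add: pderiv_monom monom_0)
    note [simp] = this[simplified]
    have "poly (pderiv (s + smult c S + smult d T)) z
      = poly ((v + monom d 1) * pderiv (u + monom c 1) - (u + monom c 1) * pderiv (v + monom d 1)) z" for z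
      by (simp add: pderiv_add pderiv_smult S T poly_monom algebra_simps
          assms(1)[unfolded legendrian_poly_def])
    then show "legendrian_poly (u + monom c 1) (v + monom d 1) (s + smult c S + smult d T)"
      unfolding legendrian_poly_def by (intro poly_ext)
    show "poly (pderiv (u + monom c 1)) z \<noteq> 0 \<or> poly (pderiv (v + monom d 1)) z \<noteq> 0" for z
    proof (rule ccontr)
      assume "\<not> ?thesis"
      then have "poly (pderiv v + [:d:]) z = 0" "c = - poly (pderiv u) z"
        by (auto simp: pderiv_add eq_neg_iff_add_eq_0 add.commute)
      then show False using c(2) by blast
    qed
    fix z :: complex
    show "cmod (poly (pderiv (u + monom c 1)) z - poly (pderiv u) z) \<le> \<epsilon>"
      "cmod (poly (pderiv (v + monom d 1)) z - poly (pderiv v) z) \<le> \<epsilon>"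
      using d c\<eta> \<eta> by (auto simp: pderiv_add)
    assume z: "cmod z \<le> 1"
    show "cmod (poly (u + monom c 1) z - poly u z) \<le> \<epsilon>" "cmod (poly (v + monom d 1) z - poly v z) \<le> \<epsilon>"
      using bd[OF c\<eta> z] bd[OF d(1) z] by (auto simp: poly_monom)
    have "cmod (c * poly S z + d * poly T z) \<le> \<eta> * C + \<eta> * C'"
      using C(2)[OF z] C'(2)[OF z] c\<eta> d(1) \<eta>(1) unfolding norm_mult[symmetric]
      by (intro norm_triangle_le add_mono) (auto simp: norm_mult intro!: mult_mono)
    then show "cmod (poly (s + smult c S + smult d T) z - poly s z) \<le> \<epsilon>"
      using \<eta>(3) by (simp add: algebra_simps)
  qed
qed

section \<open>One fast oscillation\<close>

lemma poly_lower_bound_near_circle: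
  fixes P Q :: "complex poly"
  assumes "\<And>z. cmod z = 1 \<Longrightarrow> c < cmod (poly P z) + cmod (poly Q z)"
  obtains \<rho> where "\<rho> < 1" "\<And>z. \<rho> < cmod z \<Longrightarrow> cmod z \<le> 1 \<Longrightarrow> c < cmod (poly P z) + cmod (poly Q z)"
proof -
  \<comment> \<open>The compact set on which the bound fails misses the circle, so its largest
    modulus is below 1 and serves as the radius.\<close>
  define S where "S = cball 0 1 \<inter> (\<lambda>z. cmod (poly P z) + cmod (poly Q z)) -` {..c}"
  have "closed S"
    unfolding S_def by (intro continuous_closed_preimage continuous_intros) auto
  then have "compact S"
    unfolding S_def by (metis compact_Int_closed compact_cball inf.left_idem)
  show thesis
  proof (cases "S = {}")
    case True
    then show thesis using that[of 0] by (force simp: S_def)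
  next
    case False
    then obtain x where x: "x \<in> S" "\<And>z. z \<in> S \<Longrightarrow> cmod z \<le> cmod x"
      using continuous_attains_sup[OF \<open>compact S\<close>, of cmod] continuous_on_norm_id by blast
    show thesis
    proof (rule that[of "cmod x"])
      show "cmod x < 1" using x(1) assms[of x] by (force simp: S_def)
      show "c < cmod (poly P z) + cmod (poly Q z)" if "cmod x < cmod z" "cmod z \<le> 1" for z
        using x(2)[of z] that by (force simp: S_def)
    qed
  qed
qed

text \<open>P and Q below are polynomials that agree on the circle with z^d times the stationary
  direction. The extra factors z^d and z^m are harmless because Phi is stationary along all complex
  multiples of that direction.\<close>

lemma legendrian_poly_oscillation:
  fixes a \<epsilon> \<rho> :: real
  assumes leg: "legendrian_poly u v s"
    and Phi: "\<And>z. cmod z = 1 \<Longrightarrow> 1/8 \<le> Phi (poly u z) (poly v z) (poly s z)"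
      "\<And>z. cmod z = 1 \<Longrightarrow> Phi (poly u z) (poly v z) (poly s z) \<le> 3/8 - 80 * a\<^sup>2"
    and a: "0 < a" "a \<le> 1" and \<epsilon>: "0 < \<epsilon>" "\<epsilon> \<le> 1" and \<rho>: "0 \<le> \<rho>" "\<rho> < 1"
  obtains u' v' s' p q where "legendrian_poly u' v' s'" "\<rho> < p" "p < q" "q < 1"
    "\<And>z. cmod z \<le> \<rho> \<Longrightarrow> cmod (poly u' z - poly u z) \<le> \<epsilon>"
    "\<And>z. cmod z \<le> \<rho> \<Longrightarrow> cmod (poly v' z - poly v z) \<le> \<epsilon>"
    "\<And>z. cmod z \<le> \<rho> \<Longrightarrow> cmod (poly s' z - poly s z) \<le> \<epsilon>"
    "\<And>z. cmod z \<le> \<rho> \<Longrightarrow> cmod (poly (pderiv u') z - poly (pderiv u) z) \<le> \<epsilon>"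
    "\<And>z. cmod z \<le> \<rho> \<Longrightarrow> cmod (poly (pderiv v') z - poly (pderiv v) z) \<le> \<epsilon>"
    "\<And>z. cmod z = 1 \<Longrightarrow> \<bar>Phi (poly u' z) (poly v' z) (poly s' z)
        - Phi (poly u z) (poly v z) (poly s z)\<bar> \<le> 80 * a\<^sup>2 + \<epsilon>"
    "\<And>z. p \<le> cmod z \<Longrightarrow> cmod z \<le> q \<Longrightarrow>
        a / 160 / (q - p) + 1 \<le> cmod (poly (pderiv u') z) + cmod (poly (pderiv v') z)"
proof -
  define R x where "R = (\<lambda>z. (cmod (poly u z))\<^sup>2 + (cmod (poly v z))\<^sup>2)" and "x = (\<lambda>z. R z - 1)"
  define F where "F = (\<lambda>z. cnj (poly s z) * poly u z - 2 * of_real (x z) * cnj (poly v z))"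
  define G where "G = (\<lambda>z. cnj (poly s z) * poly v z + 2 * of_real (x z) * cnj (poly u z))"
  have R_eq: "of_real (R z) = poly u z * cnj (poly u z) + poly v z * cnj (poly v z)" for z
    by (simp add: R_def complex_norm_square[symmetric])
  have x_eq: "of_real (x z) = poly u z * cnj (poly u z) + poly v z * cnj (poly v z) + (-1)" for z
    by (simp add: x_def R_eq)
  have "laurent (\<lambda>z. cnj (poly s z) * poly u z
      + (-2) * (poly u z * cnj (poly u z) + poly v z * cnj (poly v z) + (-1)) * cnj (poly v z))"
    by (intro laurent_intros)
  also have "(\<lambda>z. cnj (poly s z) * poly u z
      + (-2) * (poly u z * cnj (poly u z) + poly v z * cnj (poly v z) + (-1)) * cnj (poly v z)) = F"
    unfolding F_def x_eq by (rule ext) (simp only: minus_mult_left[symmetric] mult.assoc diff_conv_add_uminus)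
  finally have "laurent F" .
  moreover have "laurent (\<lambda>z. cnj (poly s z) * poly v z
      + 2 * (poly u z * cnj (poly u z) + poly v z * cnj (poly v z) + (-1)) * cnj (poly u z))"
    by (intro laurent_intros)
  then have "laurent G" by (simp add: G_def x_eq)
  ultimately obtain d P Q where PQ: "\<And>z. cmod z = 1 \<Longrightarrow> z ^ d * F z = poly P z"
      "\<And>z. cmod z = 1 \<Longrightarrow> z ^ d * G z = poly Q z"
    using laurent_common by blast
  have Phi': "Phi (poly u z) (poly v z) (poly s z) \<le> 3/8" if "cmod z = 1" for z
    using Phi(2)[OF that] zero_le_power2[of a] by linarith
  \<comment> \<open>Since |z^d| = 1, \<open>step_direction_ge\<close> gives the bound 1/5; lowering
    it to 1/10 makes it strict, as needed to extend it inside the circle.\<close>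
  have "1/10 < cmod (poly P z) + cmod (poly Q z)" if z: "cmod z = 1" for z
    using step_direction_ge[OF Phi(1)[OF z] Phi'[OF z]]
    unfolding PQ[OF z, symmetric] norm_mult norm_power z by (simp add: F_def G_def x_def R_def)
  then obtain \<rho>' where \<rho>': "\<rho>' < 1"
      "\<And>z. \<rho>' < cmod z \<Longrightarrow> cmod z \<le> 1 \<Longrightarrow> 1/10 < cmod (poly P z) + cmod (poly Q z)"
    using poly_lower_bound_near_circle by blast
  \<comment> \<open>In the contact condition for u + M P, v + M Q the products of M with its own
    derivative cancel. After the derivative of M (v P - u Q) is split off, 2 M G1 + M^2 G2 is left;
    B below is a primitive of it.\<close>
  define G1 G2 where "G1 = Q * pderiv u - P * pderiv v" and "G2 = Q * pderiv P - P * pderiv Q"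
  obtain C1 where C1: "\<And>n. \<exists>H. pderiv H = monom 1 n * G1 \<and> (\<forall>z. cmod z \<le> 1 \<longrightarrow> cmod (poly H z) \<le> C1 / (real n + 1))"
    using poly_primitive_monom by blast
  obtain C2 where C2: "\<And>n. \<exists>H. pderiv H = monom 1 n * G2 \<and> (\<forall>z. cmod z \<le> 1 \<longrightarrow> cmod (poly H z) \<le> C2 / (real n + 1))"
    using poly_primitive_monom by blast
  obtain H1 where H1: "pderiv (H1 n) = monom 1 n * G1"
     "cmod z \<le> 1 \<Longrightarrow> cmod (poly (H1 n) z) \<le> C1 / (real n + 1)" for n z
    using C1 by metis
  obtain H2 where H2: "pderiv (H2 n) = monom 1 n * G2"
     "cmod z \<le> 1 \<Longrightarrow> cmod (poly (H2 n) z) \<le> C2 / (real n + 1)" for n z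
    using C2 by metis
  have C0: "0 \<le> C1" "0 \<le> C2"
    using order_trans[OF norm_ge_zero H1(2)[of 0 0]] order_trans[OF norm_ge_zero H2(2)[of 0 0]] by auto
  obtain K where K: "0 < K" "\<And>y z. y \<in> {P, Q, pderiv P, pderiv Q, v * P - u * Q, pderiv u, pderiv v}
      \<Longrightarrow> cmod z \<le> 1 \<Longrightarrow> cmod (poly y z) \<le> K"
  proof -
    have "\<forall>y. \<exists>C>0. \<forall>z. cmod z \<le> 1 \<longrightarrow> cmod (poly y z) \<le> C"
      using poly_bounded_disc by metis
    then obtain C where C: "\<And>y. 0 < C y" "\<And>y z. cmod z \<le> 1 \<Longrightarrow> cmod (poly y z) \<le> C y" by metis
    let ?Y = "{P, Q, pderiv P, pderiv Q, v * P - u * Q, pderiv u, pderiv v}"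
    show thesis
    proof (rule that[of "sum C ?Y"])
      show "0 < sum C ?Y" using C(1) by (intro sum_pos) auto
      show "cmod (poly y z) \<le> sum C ?Y" if "y \<in> ?Y" "cmod z \<le> 1" for y z
        using C(2)[OF that(2), of y] member_le_sum[OF that(1), of C] C(1)
        by (meson finite.intros less_imp_le order_trans)
    qed
  qed
  have "\<forall>\<^sub>F n in sequentially. (2 * C1 + C2) / (real n + 2) < \<epsilon> / 20000"
  proof -
    have "(\<lambda>n. (2 * C1 + C2) / (real n + 2)) \<longlonglongrightarrow> 0"
      by real_asymp
    then show ?thesis using \<epsilon> by (intro order_tendstoD(2)) auto
  qed
  moreover have "\<forall>\<^sub>F n in sequentially. (real n * \<rho> ^ n + 2 * \<rho> ^ n) * K < \<epsilon> / 2"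
  proof -
    have "(\<lambda>n. (real n * \<rho> ^ n + 2 * \<rho> ^ n) * K) \<longlonglongrightarrow> (0 + 2 * 0) * K"
      using \<rho> by (intro tendsto_intros powser_times_n_limit_0 LIMSEQ_power_zero) auto
    then show ?thesis using \<epsilon> by (intro order_tendstoD(2)) auto
  qed
  moreover have "\<forall>\<^sub>F n in sequentially. max \<rho> \<rho>' < 1 - 1 / (2 * (real n + 1))"
  proof -
    have "(\<lambda>n. 1 - 1 / (2 * (real n + 1))) \<longlonglongrightarrow> 1" by real_asymp
    then show ?thesis using \<rho> \<rho>' by (intro order_tendstoD(1)) auto
  qed
  moreover have "\<forall>\<^sub>F n in sequentially. (3 * K + 1) * 40 / a < real n"
    by real_asymp
  ultimately have "\<forall>\<^sub>F n in sequentially. (2 * C1 + C2) / (real n + 2) < \<epsilon> / 20000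
      \<and> (real n * \<rho> ^ n + 2 * \<rho> ^ n) * K < \<epsilon> / 2 \<and> max \<rho> \<rho>' < 1 - 1 / (2 * (real n + 1))
      \<and> (3 * K + 1) * 40 / a < real n"
    by eventually_elim auto
  \<comment> \<open>The four requirements in turn: B is negligible for Phi; the curve and its
    derivative hardly move on the disc of radius \<rho>; the annulus lies beyond \<rho> and \<rho>';
    the derivative of the oscillation dominates the fixed terms bounded by K. The exponent of the
    oscillation is m = n + 1.\<close>
  then obtain n where n: "(2 * C1 + C2) / (real n + 2) < \<epsilon> / 20000"
      "(real n * \<rho> ^ n + 2 * \<rho> ^ n) * K < \<epsilon> / 2" "max \<rho> \<rho>' < 1 - 1 / (2 * (real n + 1))"
      "(3 * K + 1) * 40 / a < real n"
    by (auto simp: eventually_sequentially)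
  define m where "m = Suc n"
  define M where "M = monom (of_real a :: complex) m"
  define B where "B = smult (2 * of_real a) (H1 m) + smult (of_real (a\<^sup>2)) (H2 (m + m))"
  define u' v' s' where "u' = u + M * P" and "v' = v + M * Q" and "s' = s + M * (v * P - u * Q) + B"
  \<comment> \<open>Bernoulli's inequality gives p^m \<ge> 1/2. As q - p = 1 / (4 m), the claimed a
    / 160 / (q - p) is a m / 40, half of the leading term a m / 20 of the derivatives; the other
    half absorbs 3 K + 1.\<close>
  define p q where "p = 1 - 1 / (2 * real m)" and "q = 1 - 1 / (4 * real m)"
  have m: "real m = real n + 1" "0 < real m" by (auto simp: m_def)
  have B_le: "cmod (poly B z) \<le> \<epsilon> / 20000" if z: "cmod z \<le> 1" for z
  proof -
    have "cmod (poly B z) \<le> 2 * a * cmod (poly (H1 m) z) + a\<^sup>2 * cmod (poly (H2 (m + m)) z)"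
      unfolding B_def using a by (simp add: norm_triangle_le norm_mult norm_power)
    also have "\<dots> \<le> 2 * 1 * (C1 / (real n + 2)) + 1 * (C2 / (real n + 2))"
    proof (intro add_mono mult_mono)
      show "cmod (poly (H1 m) z) \<le> C1 / (real n + 2)" using H1(2)[OF z, of m] by (simp add: m_def add.commute)
      have "cmod (poly (H2 (m + m)) z) \<le> C2 / (real (m + m) + 1)" using H2(2)[OF z, of "m + m"] by simp
      also have "\<dots> \<le> C2 / (real n + 2)" using C0 by (intro divide_left_mono) (auto simp: m_def)
      finally show "cmod (poly (H2 (m + m)) z) \<le> C2 / (real n + 2)" .
    qed (use a C0 in \<open>auto intro: power_le_one\<close>)
    also have "\<dots> = (2 * C1 + C2) / (real n + 2)" by (simp add: add_divide_distrib)
    finally show ?thesis using n(1) by linarith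
  qed
  have M_deriv: "pderiv M = monom (of_real a * of_nat m) n"
    by (simp add: M_def pderiv_monom m_def mult.commute)
  have leg': "legendrian_poly u' v' s'"
  proof -
    have "poly (pderiv B) z = poly (2 * M * G1 + M * M * G2) z" for z
      by (simp add: B_def M_def pderiv_add pderiv_smult H1 H2 poly_monom power_add power2_eq_square)
    then have "pderiv B = 2 * M * G1 + M * M * G2" by (rule poly_ext)
    then have "pderiv s' = (v * pderiv u - u * pderiv v) + pderiv M * (v * P - u * Q)
        + M * (pderiv v * P + v * pderiv P - pderiv u * Q - u * pderiv Q) + (2 * M * G1 + M * M * G2)"
      unfolding s'_def using leg
      by (simp add: legendrian_poly_def pderiv_add pderiv_mult pderiv_diff algebra_simps)
    also have "\<dots> = v' * pderiv u' - u' * pderiv v'"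
      unfolding u'_def v'_def G1_def G2_def pderiv_add pderiv_mult by (simp add: algebra_simps)
    finally show ?thesis by (simp add: legendrian_poly_def)
  qed
  have pM: "poly M z = of_real a * z ^ m" for z by (simp add: M_def poly_monom)
  have small: "cmod (poly M z * poly y z) \<le> \<epsilon> / 2"
    "cmod (poly (pderiv M) z * poly y z + poly M z * poly y' z) \<le> \<epsilon> / 2"
    if z: "cmod z \<le> \<rho>" and y: "y \<in> {P, Q, v * P - u * Q}" "y' \<in> {pderiv P, pderiv Q}" for y y' z
  proof -
    have z1: "cmod z \<le> 1" using z \<rho> by simp
    have yK: "cmod (poly y z) \<le> K" "cmod (poly y' z) \<le> K" using K(2)[OF _ z1] y by auto
    have "cmod z ^ n \<le> \<rho> ^ n" using z by (intro power_mono) auto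
    moreover have "cmod z ^ m \<le> cmod z ^ n"
      unfolding m_def using z1 by (intro power_decreasing) auto
    ultimately have zn: "cmod z ^ n \<le> \<rho> ^ n" "cmod z ^ m \<le> \<rho> ^ n" by linarith+
    have 1: "cmod (poly M z * poly y z) \<le> \<rho> ^ n * K" if "cmod (poly y z) \<le> K" for y
    proof -
      have "a * cmod z ^ m * cmod (poly y z) \<le> 1 * \<rho> ^ n * K"
        using a zn that K \<rho> by (intro mult_mono) auto
      then show ?thesis using a by (simp add: pM norm_mult norm_power)
    qed
    have 2: "cmod (poly (pderiv M) z * poly y z) \<le> real m * \<rho> ^ n * K"
    proof -
      have "a * real m * cmod z ^ n * cmod (poly y z) \<le> 1 * real m * \<rho> ^ n * K"
        using a zn yK K \<rho> by (intro mult_mono) auto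
      then show ?thesis using a by (simp add: M_deriv poly_monom norm_mult norm_power del: of_nat_Suc)
    qed
    have nn: "0 \<le> \<rho> ^ n * K" using \<rho> K by simp
    then have "0 \<le> real n * (\<rho> ^ n * K)" by simp
    then show "cmod (poly M z * poly y z) \<le> \<epsilon> / 2"
      using 1[OF yK(1)] n(2) nn by (simp add: algebra_simps)
    show "cmod (poly (pderiv M) z * poly y z + poly M z * poly y' z) \<le> \<epsilon> / 2"
      using norm_triangle_ineq[of "poly (pderiv M) z * poly y z" "poly M z * poly y' z"]
        1[OF yK(2)] 2 n(2) by (simp add: algebra_simps m)
  qed
  have band: "a / 160 / (q - p) + 1 \<le> cmod (poly (pderiv u') z) + cmod (poly (pderiv v') z)"
    if z: "p \<le> cmod z" "cmod z \<le> q" for z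
  proof -
    have "q \<le> 1" by (simp add: q_def)
    then have z1: "cmod z \<le> 1" using z by linarith
    have "1 + real m * (- 1 / (2 * real m)) \<le> (1 + - 1 / (2 * real m)) ^ m"
      by (rule Bernoulli_inequality) (use m(2) in \<open>simp add: field_simps\<close>)
    then have "1/2 \<le> p ^ m" using m(2) by (simp add: p_def)
    also have "\<dots> \<le> cmod z ^ m"
      using z m(2) by (intro power_mono) (auto simp: p_def field_simps)
    also have "\<dots> \<le> cmod z ^ n"
      unfolding m_def using z1 by (intro power_decreasing) auto
    finally have zn: "1/2 \<le> cmod z ^ n" .
    have lower: "a * cmod z ^ n * (real m * cmod (poly y z) - K) - K \<le> cmod (poly (pderiv (w + M * y)) z)"
      if y: "cmod (poly (pderiv y) z) \<le> K" and w: "cmod (poly (pderiv w) z) \<le> K" for y w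
    proof -
      define b where "b = of_real a * z ^ n * (of_nat m * poly y z + z * poly (pderiv y) z)"
      have eq: "poly (pderiv (w + M * y)) z = poly (pderiv w) z + b"
        by (simp add: b_def pderiv_add pderiv_mult M_deriv poly_monom pM m_def algebra_simps del: of_nat_Suc)
      have "cmod (z * poly (pderiv y) z) \<le> 1 * K"
        unfolding norm_mult using z1 y by (intro mult_mono) auto
      then have "real m * cmod (poly y z) - K \<le> cmod (of_nat m * poly y z + z * poly (pderiv y) z)"
        using norm_diff_ineq[of "of_nat m * poly y z" "z * poly (pderiv y) z"] by (simp add: norm_mult)
      then have "a * cmod z ^ n * (real m * cmod (poly y z) - K) \<le> cmod b"
        unfolding b_def norm_mult norm_power using a by (simp add: mult_left_mono)
      then show ?thesis
        unfolding eq using norm_diff_ineq[of b "poly (pderiv w) z"] w by (simp add: add.commute)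
    qed
    have big: "(3 * K + 1) * 40 \<le> a * real m"
      using n(4) a by (simp add: m field_simps)
    then have big': "(3 * K + 1) * 40 \<le> real m"
      using mult_right_mono[OF a(2), of "real m"] by simp
    have "\<rho>' < cmod z" using n(3) z by (simp add: p_def m)
    then have PQz: "1/10 < cmod (poly P z) + cmod (poly Q z)" using \<rho>'(2) z1 by blast
    have "1/2 * (real m * (1/10) - 2 * K) \<le> cmod z ^ n * (real m * (cmod (poly P z) + cmod (poly Q z)) - 2 * K)"
      using zn PQz m(2) big' K(1) by (intro mult_mono diff_mono) auto
    then have "a * (1/2 * (real m * (1/10) - 2 * K)) \<le> a * (cmod z ^ n * (real m * (cmod (poly P z) + cmod (poly Q z)) - 2 * K))"
      using a by (intro mult_left_mono) auto
    also have "\<dots> = a * cmod z ^ n * (real m * cmod (poly P z) - K) + a * cmod z ^ n * (real m * cmod (poly Q z) - K)"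
      by (simp add: algebra_simps)
    also have "\<dots> \<le> cmod (poly (pderiv u') z) + cmod (poly (pderiv v') z) + 2 * K"
      using lower[of P u] lower[of Q v] K(2)[OF _ z1] by (simp add: u'_def v'_def)
    finally have "a * real m / 20 - a * K - 2 * K \<le> cmod (poly (pderiv u') z) + cmod (poly (pderiv v') z)"
      by (simp add: algebra_simps)
    moreover have "a * K \<le> K" using a K by simp
    moreover have "a / 160 / (q - p) = a * real m / 40"
      using m(2) by (simp add: p_def q_def field_simps)
    ultimately show ?thesis using big by (simp add: field_simps)
  qed
  have circle: "\<bar>Phi (poly u' z) (poly v' z) (poly s' z) - Phi (poly u z) (poly v z) (poly s z)\<bar>
      \<le> 80 * a\<^sup>2 + \<epsilon>" if z: "cmod z = 1" for z
  proof -
    \<comment> \<open>On the circle M P = w F and M Q = w G with |w| = a, so apart from B the move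
      is exactly the step of \<open>Phi_step_le\<close>.\<close>
    define w where "w = of_real a * z ^ m * z ^ d"
    have w: "cmod w = a" using a z by (simp add: w_def norm_mult norm_power)
    define U V S where "U = poly u z + w * F z" and "V = poly v z + w * G z"
      and "S = poly s z - 2 * of_real (x z) * of_real (R z) * w"
    have "\<bar>Phi U V S - Phi (poly u z) (poly v z) (poly s z)\<bar> \<le> 80 * (cmod w)\<^sup>2"
      unfolding U_def V_def S_def F_def G_def x_def R_def
      by (rule Phi_step_le) (use Phi'[OF z] w a in auto)
    then have 1: "\<bar>Phi U V S - Phi (poly u z) (poly v z) (poly s z)\<bar> \<le> 80 * a\<^sup>2" by (simp add: w)
    then have "Phi U V S \<le> 3/8" using Phi(2)[OF z] by linarith
    note bd = Phi_bounds(3-5)[OF this]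
    have MP: "poly M z * poly P z = w * F z" and MQ: "poly M z * poly Q z = w * G z"
      unfolding PQ[OF z, symmetric] by (simp_all add: pM w_def)
    have "poly v z * F z - poly u z * G z = - 2 * of_real (x z) * of_real (R z)"
      unfolding F_def G_def R_eq by (simp add: algebra_simps)
    then have *: "w * (poly v z * F z - poly u z * G z) = - 2 * of_real (x z) * of_real (R z) * w" by simp
    have "poly M z * poly (v * P - u * Q) z
        = poly v z * (poly M z * poly P z) - poly u z * (poly M z * poly Q z)"
      by (simp add: algebra_simps)
    also have "\<dots> = - 2 * of_real (x z) * of_real (R z) * w"
      unfolding MP MQ *[symmetric] by (simp add: algebra_simps)
    finally have "poly M z * poly (v * P - u * Q) z = - 2 * of_real (x z) * of_real (R z) * w" .
    \<comment> \<open>The zeros fit the pattern of \<open>Phi_perturb\<close>: only the third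
      coordinate is disturbed.\<close>
    then have eqs: "poly u' z = U + 0" "poly v' z = V + 0" "poly s' z = S + poly B z"
      using MP MQ by (simp_all add: u'_def v'_def s'_def U_def V_def S_def)
    have "\<bar>Phi (poly u' z) (poly v' z) (poly s' z) - Phi U V S\<bar> \<le> 20000 * (\<epsilon> / 20000)"
      unfolding eqs using bd B_le[of z] z \<epsilon> by (intro Phi_perturb) auto
    then show ?thesis using 1 by linarith
  qed
  show thesis
  proof (rule that[OF leg', of p q])
    show "\<rho> < p" using n(3) by (simp add: p_def m)
    show "p < q" "q < 1" using m(2) by (auto simp: p_def q_def field_simps)
    show "cmod (poly u' z - poly u z) \<le> \<epsilon>" "cmod (poly v' z - poly v z) \<le> \<epsilon>"
      "cmod (poly (pderiv u') z - poly (pderiv u) z) \<le> \<epsilon>" "cmod (poly (pderiv v') z - poly (pderiv v) z) \<le> \<epsilon>"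
      if z: "cmod z \<le> \<rho>" for z
      using small(1)[OF z, of P "pderiv P"] small(1)[OF z, of Q "pderiv P"]
        small(2)[OF z, of P "pderiv P"] small(2)[OF z, of Q "pderiv Q"] \<epsilon>
      by (simp_all add: u'_def v'_def pderiv_add pderiv_mult add.commute mult.commute)
    show "cmod (poly s' z - poly s z) \<le> \<epsilon>" if z: "cmod z \<le> \<rho>" for z
    proof -
      have "cmod (poly s' z - poly s z) \<le> cmod (poly M z * poly (v * P - u * Q) z) + cmod (poly B z)"
        using norm_triangle_ineq[of "poly M z * poly (v * P - u * Q) z" "poly B z"]
        by (simp add: s'_def)
      also have "\<dots> \<le> \<epsilon> / 2 + \<epsilon> / 20000"
        using small(1)[OF z, of "v * P - u * Q" "pderiv P"] B_le[of z] z \<rho> by (intro add_mono) auto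
      finally show ?thesis using \<epsilon> by simp
    qed
  qed (use circle band in auto)
qed

text \<open>In a stage \<open>(u, v, s, \<rho>, \<eta>)\<close> the later stages move \<open>u\<close>, \<open>v\<close>, \<open>s\<close> and the
  derivatives of \<open>u\<close> and \<open>v\<close> by at most \<open>2 \<eta>\<close> on the disc of radius \<open>\<rho>\<close>.\<close>

type_synonym stage = "complex poly \<times> complex poly \<times> complex poly \<times> real \<times> real"

text \<open>The margin 1 / (8 (n + 2)) left below 1/8 is a budget: each stage may spend its
  decrease, and Phi stays within 1/8 of 1/4 forever. The derivatives exceed 4 \<eta> in sum while
  later stages move each of the two by at most 2 \<eta>, so they have no common zero in the
  limit.\<close>

definition stage_inv :: "nat \<Rightarrow> stage \<Rightarrow> bool" where
  "stage_inv n = (\<lambda>(u, v, s, \<rho>, \<eta>). legendrian_poly u v s \<and> 0 \<le> \<rho> \<and> \<rho> < 1 \<and> 0 < \<eta> \<and> \<eta> \<le> 1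
     \<and> (\<forall>z. cmod z = 1 \<longrightarrow> \<bar>Phi (poly u z) (poly v z) (poly s z) - 1/4\<bar> \<le> 1/8 - 1 / (8 * (real n + 2)))
     \<and> (\<forall>z. cmod z \<le> \<rho> \<longrightarrow> 4 * \<eta> < cmod (poly (pderiv u) z) + cmod (poly (pderiv v) z)))"

text \<open>The reserve 4 \<eta>' on the annulus covers what later stages may take away, leaving a
  crossing cost 1 / (8000 (n + 3)), whose sum diverges. Halving \<eta> bounds the total later
  movement by 2 \<eta>; halving 1 - \<rho> lets the discs exhaust the unit disc.\<close>

definition stage_next :: "nat \<Rightarrow> stage \<Rightarrow> stage \<Rightarrow> bool" where
  "stage_next n = (\<lambda>(u, v, s, \<rho>, \<eta>) (u', v', s', \<rho>', \<eta>').
     (\<forall>z. cmod z \<le> \<rho> \<longrightarrow> cmod (poly u' z - poly u z) \<le> \<eta> \<and> cmod (poly v' z - poly v z) \<le> \<eta>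
        \<and> cmod (poly s' z - poly s z) \<le> \<eta>
        \<and> cmod (poly (pderiv u') z - poly (pderiv u) z) \<le> \<eta>
        \<and> cmod (poly (pderiv v') z - poly (pderiv v) z) \<le> \<eta>)
     \<and> \<eta>' \<le> \<eta> / 2 \<and> (1 + \<rho>) / 2 \<le> \<rho>'
     \<and> (\<exists>p q. \<rho> \<le> p \<and> p < q \<and> q \<le> \<rho>' \<and> (\<forall>z. p \<le> cmod z \<longrightarrow> cmod z \<le> q \<longrightarrow>
          1 / (8000 * (real n + 3)) / (q - p) + 4 * \<eta>' \<le> cmod (poly (pderiv u') z) + cmod (poly (pderiv v') z))))"

section \<open>The sequence of stages\<close>

lemma stage_inv_0: "stage_inv 0 ([:1:], [:0, 1/100:], [:1/2, -1/100:], 0, 1/800)"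
proof -
  \<comment> \<open>The start is a small affine disc centred at (1, 0, 1/2), where Phi = 1/4. At n =
    0 the permitted deviation is 1/8 - 1/16, and 4 \<eta> = 1/200 is below the derivative 1/100 of
    v.\<close>
  have "\<bar>Phi 1 (z / 100) (1/2 - z / 100) - 1/4\<bar> \<le> 1/16" if z: "cmod z = 1" for z
  proof -
    have "\<bar>cmod (1/2 - z / 100) - cmod (1/2)\<bar> \<le> cmod (z / 100)"
      using norm_triangle_ineq3[of "1/2 - z / 100" "1/2"] by simp
    also have "cmod (z / 100) = 1/100" using z by (simp add: norm_divide)
    finally have b: "\<bar>cmod (1/2 - z / 100) - 1/2\<bar> \<le> 1/100" by (simp add: norm_divide)
    then have "(49/100)\<^sup>2 \<le> (cmod (1/2 - z / 100))\<^sup>2" "(cmod (1/2 - z / 100))\<^sup>2 \<le> (51/100)\<^sup>2"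
      by (intro power_mono; linarith)+
    moreover have "Phi 1 (z / 100) (1/2 - z / 100) = (1/10000)\<^sup>2 + (cmod (1/2 - z / 100))\<^sup>2"
      using z by (simp add: Phi_def norm_divide power_divide)
    ultimately show ?thesis unfolding abs_le_iff by (simp add: power2_eq_square)
  qed
  then show ?thesis
    by (simp add: stage_inv_def legendrian_poly_def pderiv_pCons norm_divide)
qed

text \<open>An oscillation followed by a generic perturbation: the first creates the long annulus,
  but its derivatives may have common zeros, which the second removes.\<close>

lemma stage_step:
  assumes "stage_inv n st"
  shows "\<exists>st'. stage_inv (Suc n) st' \<and> stage_next n st st'"
proof -
  obtain u v s \<rho> \<eta> where st: "st = (u, v, s, \<rho>, \<eta>)" by (cases st) auto
  have leg: "legendrian_poly u v s" and \<rho>: "0 \<le> \<rho>" "\<rho> < 1" and \<eta>: "0 < \<eta>" "\<eta> \<le> 1"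
    and Phi: "\<And>z. cmod z = 1 \<Longrightarrow> \<bar>Phi (poly u z) (poly v z) (poly s z) - 1/4\<bar> \<le> 1/8 - 1 / (8 * (real n + 2))"
    using assms by (auto simp: st stage_inv_def)
  \<comment> \<open>On the circle the oscillation costs 80 a^2 + \<epsilon> and the perturbation
    20000 \<epsilon>', in total at most 82 a^2. This a makes that fit the decrease 1 / (8 (n + 2) (n
    + 3)) of the budget.\<close>
  define a where "a = 1 / (50 * (real n + 3))"
  define \<epsilon> where "\<epsilon> = min (\<eta> / 2) (a\<^sup>2)"
  define \<epsilon>' where "\<epsilon>' = min (min (\<eta> / 2) (1/4)) (a\<^sup>2 / 20000)"
  have a: "0 < a" "a \<le> 1" by (auto simp: a_def)
  have \<epsilon>: "0 < \<epsilon>" "\<epsilon> \<le> \<eta> / 2" "\<epsilon> \<le> a\<^sup>2" and \<epsilon>': "0 < \<epsilon>'" "\<epsilon>' \<le> \<eta> / 2" "\<epsilon>' \<le> 1/4" "20000 * \<epsilon>' \<le> a\<^sup>2"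
    using \<eta> a by (auto simp: \<epsilon>_def \<epsilon>'_def)
  have "(1 / (50 * x))\<^sup>2 = 1 / 2500 * (1 / x\<^sup>2)" for x :: real
    by (simp add: power_mult_distrib power_one_over)
  then have "a\<^sup>2 = 1 / 2500 * (1 / (real n + 3)\<^sup>2)"
    unfolding a_def .
  then have "82 * a\<^sup>2 = 82 / 2500 * (1 / (real n + 3)\<^sup>2)"
    by simp
  also have "\<dots> \<le> 1/8 * (1 / ((real n + 2) * (real n + 3)))"
    by (intro mult_mono divide_left_mono) (auto simp: power2_eq_square)
  also have "\<dots> = 1 / (8 * (real n + 2)) - 1 / (8 * (real n + 3))"
  proof -
    have *: "1/8 * (1 / (x * y)) = 1 / (8 * x) - 1 / (8 * y)" if "y = x + 1" "0 < x" for x y :: real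
      using that by (simp add: divide_simps)
    show ?thesis by (rule *) auto
  qed
  finally have a2: "82 * a\<^sup>2 \<le> 1 / (8 * (real n + 2)) - 1 / (8 * (real n + 3))" .
  have pos: "0 \<le> 1 / (8 * (real n + 2))" "0 \<le> 1 / (8 * (real n + 3))" by auto
  have P1: "1/8 \<le> Phi (poly u z) (poly v z) (poly s z)"
    "Phi (poly u z) (poly v z) (poly s z) \<le> 3/8 - 80 * a\<^sup>2" if "cmod z = 1" for z
    using Phi[OF that] a2 pos zero_le_power2[of a] unfolding abs_le_iff by linarith+
  have "\<epsilon> \<le> 1" using \<epsilon> \<eta> by linarith
  obtain u1 v1 s1 p q where 1: "legendrian_poly u1 v1 s1" "\<rho> < p" "p < q" "q < 1"
    "\<And>z. cmod z \<le> \<rho> \<Longrightarrow> cmod (poly u1 z - poly u z) \<le> \<epsilon>"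
    "\<And>z. cmod z \<le> \<rho> \<Longrightarrow> cmod (poly v1 z - poly v z) \<le> \<epsilon>"
    "\<And>z. cmod z \<le> \<rho> \<Longrightarrow> cmod (poly s1 z - poly s z) \<le> \<epsilon>"
    "\<And>z. cmod z \<le> \<rho> \<Longrightarrow> cmod (poly (pderiv u1) z - poly (pderiv u) z) \<le> \<epsilon>"
    "\<And>z. cmod z \<le> \<rho> \<Longrightarrow> cmod (poly (pderiv v1) z - poly (pderiv v) z) \<le> \<epsilon>"
    "\<And>z. cmod z = 1 \<Longrightarrow> \<bar>Phi (poly u1 z) (poly v1 z) (poly s1 z)
        - Phi (poly u z) (poly v z) (poly s z)\<bar> \<le> 80 * a\<^sup>2 + \<epsilon>"
    "\<And>z. p \<le> cmod z \<Longrightarrow> cmod z \<le> q \<Longrightarrow>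
        a / 160 / (q - p) + 1 \<le> cmod (poly (pderiv u1) z) + cmod (poly (pderiv v1) z)"
    using legendrian_poly_oscillation[OF leg P1 a \<epsilon>(1) \<open>\<epsilon> \<le> 1\<close> \<rho>] by blast
  obtain u2 v2 s2 where 2: "legendrian_poly u2 v2 s2"
    "\<And>z. poly (pderiv u2) z \<noteq> 0 \<or> poly (pderiv v2) z \<noteq> 0"
    "\<And>z. cmod z \<le> 1 \<Longrightarrow> cmod (poly u2 z - poly u1 z) \<le> \<epsilon>'"
    "\<And>z. cmod z \<le> 1 \<Longrightarrow> cmod (poly v2 z - poly v1 z) \<le> \<epsilon>'"
    "\<And>z. cmod z \<le> 1 \<Longrightarrow> cmod (poly s2 z - poly s1 z) \<le> \<epsilon>'"
    "\<And>z. cmod (poly (pderiv u2) z - poly (pderiv u1) z) \<le> \<epsilon>'"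
    "\<And>z. cmod (poly (pderiv v2) z - poly (pderiv v1) z) \<le> \<epsilon>'"
    using legendrian_poly_generic[OF 1(1) \<epsilon>'(1)] by blast
  \<comment> \<open>The new disc contains the annulus, so that later stages respect it, and covers
    at least half of the remaining distance to the circle.\<close>
  define \<rho>2 where "\<rho>2 = max q ((1 + \<rho>) / 2)"
  have \<rho>2: "0 \<le> \<rho>2" "\<rho>2 < 1" "q \<le> \<rho>2" "(1 + \<rho>) / 2 \<le> \<rho>2" using \<rho> 1(4) by (auto simp: \<rho>2_def le_max_iff_disj)
  have "\<exists>x\<in>cball 0 \<rho>2. \<forall>z\<in>cball 0 \<rho>2. cmod (poly (pderiv u2) x) + cmod (poly (pderiv v2) x)
      \<le> cmod (poly (pderiv u2) z) + cmod (poly (pderiv v2) z)"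
    using \<rho>2 by (intro continuous_attains_inf continuous_intros) auto
  then obtain x where x: "\<And>z. cmod z \<le> \<rho>2 \<Longrightarrow> cmod (poly (pderiv u2) x) + cmod (poly (pderiv v2) x)
      \<le> cmod (poly (pderiv u2) z) + cmod (poly (pderiv v2) z)" by (metis mem_cball_0)
  define \<mu> where "\<mu> = cmod (poly (pderiv u2) x) + cmod (poly (pderiv v2) x)"
  have "0 < \<mu>" using 2(2)[of x] by (auto simp: \<mu>_def add_pos_nonneg add_nonneg_pos)
  \<comment> \<open>The bound \<mu> / 8 keeps 4 \<eta>2 below the minimum \<mu> of the derivatives.
    The bound 1/8 fits 4 \<eta>2 into the summand 1 won by the oscillation, of which the
    perturbation uses at most 1/2.\<close>
  define \<eta>2 where "\<eta>2 = min (min (\<eta> / 2) (1/8)) (\<mu> / 8)"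
  have \<eta>2: "0 < \<eta>2" "\<eta>2 \<le> \<eta> / 2" "\<eta>2 \<le> 1/8" "\<eta>2 \<le> \<mu> / 8"
    using \<eta> \<open>0 < \<mu>\<close> by (auto simp: \<eta>2_def)
  have band: "1 / (8000 * (real n + 3)) / (q - p) + 4 * \<eta>2
      \<le> cmod (poly (pderiv u2) z) + cmod (poly (pderiv v2) z)"
    if z: "p \<le> cmod z" "cmod z \<le> q" for z
  proof -
    have eq: "a / 160 = 1 / (8000 * (real n + 3))" by (simp add: a_def)
    have "1 / (8000 * (real n + 3)) / (q - p) + 1 \<le> cmod (poly (pderiv u1) z) + cmod (poly (pderiv v1) z)"
      using 1(11)[OF z] by (simp only: eq)
    moreover have "cmod (poly (pderiv u1) z) \<le> cmod (poly (pderiv u2) z) + 1/4"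
      "cmod (poly (pderiv v1) z) \<le> cmod (poly (pderiv v2) z) + 1/4"
      using norm_triangle_ineq3[of "poly (pderiv u2) z" "poly (pderiv u1) z"] 2(6)[of z]
        norm_triangle_ineq3[of "poly (pderiv v2) z" "poly (pderiv v1) z"] 2(7)[of z] \<epsilon>'(3)
      unfolding abs_le_iff by linarith+
    ultimately show ?thesis
      using \<eta>2(3) by linarith
  qed
  have ex: "\<exists>p q. \<rho> \<le> p \<and> p < q \<and> q \<le> \<rho>2 \<and> (\<forall>z. p \<le> cmod z \<longrightarrow> cmod z \<le> q \<longrightarrow>
      1 / (8000 * (real n + 3)) / (q - p) + 4 * \<eta>2 \<le> cmod (poly (pderiv u2) z) + cmod (poly (pderiv v2) z))"
    by (rule exI[of _ p], rule exI[of _ q]) (use 1(2,3) \<rho>2 band in auto)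
  have "stage_inv (Suc n) (u2, v2, s2, \<rho>2, \<eta>2)"
    unfolding stage_inv_def prod.case
  proof (intro conjI allI impI)
    fix z :: complex
    show "4 * \<eta>2 < cmod (poly (pderiv u2) z) + cmod (poly (pderiv v2) z)" if "cmod z \<le> \<rho>2"
      using x[OF that] \<eta>2 \<open>0 < \<mu>\<close> by (simp add: \<mu>_def[symmetric])
    assume z: "cmod z = 1"
    have d1: "\<bar>Phi (poly u1 z) (poly v1 z) (poly s1 z) - Phi (poly u z) (poly v z) (poly s z)\<bar> \<le> 81 * a\<^sup>2"
      using 1(10)[OF z] \<epsilon>(3) by linarith
    then have "Phi (poly u1 z) (poly v1 z) (poly s1 z) \<le> 3/8"
      using Phi[OF z] a2 pos zero_le_power2[of a] unfolding abs_le_iff by linarith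
    note bd = Phi_bounds(3-5)[OF this]
    have "\<bar>Phi (poly u1 z + (poly u2 z - poly u1 z)) (poly v1 z + (poly v2 z - poly v1 z))
          (poly s1 z + (poly s2 z - poly s1 z)) - Phi (poly u1 z) (poly v1 z) (poly s1 z)\<bar> \<le> 20000 * \<epsilon>'"
      using bd 2(3,4,5)[of z] z \<epsilon>' by (intro Phi_perturb) auto
    then have "\<bar>Phi (poly u2 z) (poly v2 z) (poly s2 z) - Phi (poly u1 z) (poly v1 z) (poly s1 z)\<bar> \<le> a\<^sup>2"
      using \<epsilon>' by simp
    then have "\<bar>Phi (poly u2 z) (poly v2 z) (poly s2 z) - 1/4\<bar> \<le> 1/8 - 1 / (8 * (real n + 3))"
      using d1 Phi[OF z] a2 unfolding abs_le_iff by linarith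
    then show "\<bar>Phi (poly u2 z) (poly v2 z) (poly s2 z) - 1/4\<bar> \<le> 1/8 - 1 / (8 * (real (Suc n) + 2))"
      by (simp add: algebra_simps)
  qed (use 2(1) \<rho>2 \<eta>2 in auto)
  moreover have "stage_next n st (u2, v2, s2, \<rho>2, \<eta>2)"
    unfolding stage_next_def st prod.case
  proof (intro conjI allI impI)
    have tri: "cmod (z - x) \<le> \<eta>" if "cmod (z - y) \<le> \<epsilon>'" "cmod (y - x) \<le> \<epsilon>" for x y z
      using norm_triangle_ineq[of "z - y" "y - x"] that \<epsilon>(2) \<epsilon>'(2) by simp
    fix z :: complex
    assume z: "cmod z \<le> \<rho>"
    then have z1: "cmod z \<le> 1" using \<rho> by simp
    show "cmod (poly u2 z - poly u z) \<le> \<eta>" by (rule tri[OF 2(3)[OF z1] 1(5)[OF z]])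
    show "cmod (poly v2 z - poly v z) \<le> \<eta>" by (rule tri[OF 2(4)[OF z1] 1(6)[OF z]])
    show "cmod (poly s2 z - poly s z) \<le> \<eta>" by (rule tri[OF 2(5)[OF z1] 1(7)[OF z]])
    show "cmod (poly (pderiv u2) z - poly (pderiv u) z) \<le> \<eta>" by (rule tri[OF 2(6) 1(8)[OF z]])
    show "cmod (poly (pderiv v2) z - poly (pderiv v) z) \<le> \<eta>" by (rule tri[OF 2(7) 1(9)[OF z]])
  qed (use ex \<rho>2 \<eta>2 in auto)
  ultimately show ?thesis by blast
qed

section \<open>Passage to the limit\<close>

lemma geometric_telescope:
  fixes F :: "nat \<Rightarrow> 'a::real_normed_vector" and \<eta> :: "nat \<Rightarrow> real"
  assumes "\<And>k. n \<le> k \<Longrightarrow> norm (F (Suc k) - F k) \<le> \<eta> k" "\<And>k. \<eta> (Suc k) \<le> \<eta> k / 2" "\<And>k. 0 < \<eta> k"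
    and "n \<le> m"
  shows "norm (F m - F n) \<le> 2 * \<eta> n"
proof -
  \<comment> \<open>The subtracted term carries the induction: by halving, \<eta> m \<le> 2 * \<eta>
    m - 2 * \<eta> (Suc m).\<close>
  have "norm (F m - F n) \<le> 2 * \<eta> n - 2 * \<eta> m"
    using \<open>n \<le> m\<close>
  proof (induction m rule: dec_induct)
    case (step m)
    have "norm (F (Suc m) - F n) \<le> norm (F (Suc m) - F m) + norm (F m - F n)"
      using norm_triangle_ineq[of "F (Suc m) - F m" "F m - F n"] by simp
    then show ?case using step assms(1)[of m] assms(2)[of m] by simp
  qed simp
  then show ?thesis using assms(3)[of m] by simp
qed

text \<open>Each step is controlled only on the disc of radius \<rho> n. Since these discs exhaust
  the unit disc, convergence is uniform on a closed disc around every point, and the derivatives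
  converge with it.\<close>

lemma poly_sequence_limit:
  fixes U :: "nat \<Rightarrow> complex poly" and \<eta> \<rho> :: "nat \<Rightarrow> real"
  assumes step: "\<And>n z. cmod z \<le> \<rho> n \<Longrightarrow> cmod (poly (U (Suc n)) z - poly (U n) z) \<le> \<eta> n"
    and \<eta>: "\<And>n. \<eta> (Suc n) \<le> \<eta> n / 2" "\<And>n. 0 < \<eta> n" "\<eta> \<longlonglongrightarrow> 0"
    and \<rho>: "incseq \<rho>" "\<And>r. r < 1 \<Longrightarrow> \<exists>n. r \<le> \<rho> n"
  obtains f f' where "\<And>z. z \<in> ball 0 1 \<Longrightarrow> (f has_field_derivative f' z) (at z)"
    "\<And>z. z \<in> ball 0 1 \<Longrightarrow> (\<lambda>n. poly (U n) z) \<longlonglongrightarrow> f z"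
    "\<And>z. z \<in> ball 0 1 \<Longrightarrow> (\<lambda>n. poly (pderiv (U n)) z) \<longlonglongrightarrow> f' z"
proof -
  have tele: "cmod (poly (U m) z - poly (U n) z) \<le> 2 * \<eta> n" if "cmod z \<le> \<rho> n" "n \<le> m" for m n z
    using \<rho>(1) that by (intro geometric_telescope[where F = "\<lambda>n. poly (U n) z"] step \<eta>)
      (auto simp: incseq_def intro: order_trans)
  define f where "f = (\<lambda>z. lim (\<lambda>n. poly (U n) z))"
  have lim: "(\<lambda>n. poly (U n) z) \<longlonglongrightarrow> f z" if "z \<in> ball 0 1" for z
  proof -
    obtain N where N: "cmod z \<le> \<rho> N" using \<rho>(2)[of "cmod z"] \<open>z \<in> ball 0 1\<close> by auto
    have "Cauchy (\<lambda>n. poly (U n) z)"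
      unfolding Cauchy_altdef2
    proof (intro allI impI)
      fix e :: real assume "0 < e"
      then have "\<forall>\<^sub>F n in sequentially. \<eta> n < e / 2"
        using \<eta>(3) by (intro order_tendstoD(2)) auto
      then obtain M where M: "\<And>n. M \<le> n \<Longrightarrow> \<eta> n < e / 2" by (auto simp: eventually_sequentially)
      have "cmod z \<le> \<rho> (max M N)" using N \<rho>(1) by (meson incseqD max.cobounded2 order_trans)
      then have "\<forall>n\<ge>max M N. dist (poly (U n) z) (poly (U (max M N)) z) < e"
        using tele[of z "max M N"] M[of "max M N"] by (fastforce simp: dist_norm)
      then show "\<exists>N. \<forall>n\<ge>N. dist (poly (U n) z) (poly (U N) z) < e" by blast
    qed
    then show ?thesis
      unfolding f_def by (simp add: Cauchy_convergent_iff convergent_LIMSEQ_iff)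
  qed
  have dist: "cmod (poly (U n) z - f z) \<le> 2 * \<eta> n" if "cmod z \<le> \<rho> n" "z \<in> ball 0 1" for n z
  proof (rule LIMSEQ_le_const2)
    show "(\<lambda>m. cmod (poly (U n) z - poly (U m) z)) \<longlonglongrightarrow> cmod (poly (U n) z - f z)"
      using lim that by (intro tendsto_intros) auto
    show "\<exists>N. \<forall>m\<ge>N. cmod (poly (U n) z - poly (U m) z) \<le> 2 * \<eta> n"
      using tele[OF that(1)] by (auto simp: norm_minus_commute)
  qed
  have "\<exists>f'. \<forall>z\<in>ball 0 1. (f has_field_derivative f' z) (at z)
      \<and> (\<lambda>n. poly (pderiv (U n)) z) \<longlonglongrightarrow> f' z"
  proof (rule has_complex_derivative_uniform_sequence[where f = "\<lambda>n. poly (U n)"])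
    fix x :: complex assume x: "x \<in> ball 0 1"
    define d where "d = (1 - cmod x) / 2"
    have d: "0 < d" "cmod x + d < 1" using x by (auto simp: d_def field_simps)
    obtain N where N: "cmod x + d \<le> \<rho> N" using \<rho>(2)[OF d(2)] by blast
    have sub: "cmod y \<le> cmod x + d" if "y \<in> cball x d" for y
      using that norm_triangle_sub[of y x] by (simp add: dist_norm norm_minus_commute)
    have "uniform_limit (cball x d) (\<lambda>n. poly (U n)) f sequentially"
    proof (rule uniform_limitI)
      fix e :: real assume "0 < e"
      then have "\<forall>\<^sub>F n in sequentially. \<eta> n < e / 2"
        using \<eta>(3) by (intro order_tendstoD(2)) auto
      moreover have "\<forall>\<^sub>F n in sequentially. N \<le> n" by (rule eventually_ge_at_top)
      ultimately show "\<forall>\<^sub>F n in sequentially. \<forall>y\<in>cball x d. dist (poly (U n) y) (f y) < e"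
      proof eventually_elim
        case (elim n)
        show ?case
        proof
          fix y assume y: "y \<in> cball x d"
          have "cmod y \<le> \<rho> n" using sub[OF y] N \<rho>(1) elim by (meson incseqD order_trans)
          moreover have "y \<in> ball 0 1" using sub[OF y] d by simp
          ultimately show "dist (poly (U n) y) (f y) < e"
            using dist[of y n] elim by (simp add: dist_norm)
        qed
      qed
    qed
    moreover have "cball x d \<subseteq> ball 0 1" using sub d by force
    ultimately show "\<exists>d>0. cball x d \<subseteq> ball 0 1 \<and> uniform_limit (cball x d) (\<lambda>n. poly (U n)) f sequentially"
      using d by blast
  qed (auto intro: poly_DERIV)
  then show thesis using that lim by blast
qed

theorem bounded_oscillating_legendrian_curve:
  obtains f f' g g' h :: "complex \<Rightarrow> complex" and p q :: "nat \<Rightarrow> real" where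
    "\<And>z. z \<in> ball 0 1 \<Longrightarrow> (f has_field_derivative f' z) (at z)"
    "\<And>z. z \<in> ball 0 1 \<Longrightarrow> (g has_field_derivative g' z) (at z)"
    "\<And>z. z \<in> ball 0 1 \<Longrightarrow> (h has_field_derivative (g z * f' z - f z * g' z)) (at z)"
    "\<And>z. z \<in> ball 0 1 \<Longrightarrow> cmod (f z) \<le> 2 \<and> cmod (g z) \<le> 2 \<and> cmod (h z) \<le> 2"
    "\<And>z. z \<in> ball 0 1 \<Longrightarrow> f' z \<noteq> 0 \<or> g' z \<noteq> 0"
    "\<And>n. p n < q n" "\<And>n. q n \<le> p (Suc n)" "\<And>n. q n < 1" "\<And>r. r < 1 \<Longrightarrow> \<exists>n. r \<le> p n"
    "\<And>n z. p n \<le> cmod z \<Longrightarrow> cmod z \<le> q n \<Longrightarrow>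
       1 / (8000 * (real n + 3)) / (q n - p n) \<le> cmod (f' z) + cmod (g' z)"
proof -
  obtain F where F: "\<And>n. stage_inv n (F n)" "\<And>n. stage_next n (F n) (F (Suc n))"
    using dependent_nat_choice[of stage_inv stage_next] stage_inv_0 stage_step by blast
  define U V S \<rho> \<eta> where "U n = fst (F n)" and "V n = fst (snd (F n))" and "S n = fst (snd (snd (F n)))"
    and "\<rho> n = fst (snd (snd (snd (F n))))" and "\<eta> n = snd (snd (snd (snd (F n))))" for n
  have Feq: "F n = (U n, V n, S n, \<rho> n, \<eta> n)" for n
    by (simp add: U_def V_def S_def \<rho>_def \<eta>_def)
  note inv = F(1)[unfolded Feq stage_inv_def prod.case]
  note nxt = F(2)[unfolded Feq stage_next_def prod.case]
  have leg: "pderiv (S n) = V n * pderiv (U n) - U n * pderiv (V n)" for n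
    using inv[of n] by (simp add: legendrian_poly_def)
  have \<rho>01: "0 \<le> \<rho> n" "\<rho> n < 1" and \<eta>: "0 < \<eta> n" "\<eta> n \<le> 1" "\<eta> (Suc n) \<le> \<eta> n / 2"
    and \<rho>step: "(1 + \<rho> n) / 2 \<le> \<rho> (Suc n)" for n
    using inv[of n] nxt[of n] by blast+
  have "\<eta> n \<le> (1/2) ^ n" for n
  proof (induction n)
    case (Suc n)
    then show ?case using \<eta>(3)[of n] by simp
  qed (use \<eta>(2) in simp)
  then have \<eta>0: "\<eta> \<longlonglongrightarrow> 0"
    using \<eta>(1) by (intro tendsto_sandwich[OF _ _ tendsto_const LIMSEQ_power_zero[of "1/2::real"]])
      (auto simp: less_imp_le)
  have incr: "incseq \<rho>"
  proof (rule incseq_SucI)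
    show "\<rho> n \<le> \<rho> (Suc n)" for n using \<rho>step[of n] \<rho>01[of n] by simp
  qed
  have "1 - \<rho> n \<le> (1/2) ^ n" for n
  proof (induction n)
    case (Suc n)
    then show ?case using \<rho>step[of n] by simp
  qed (use \<rho>01 in simp)
  then have exh: "\<exists>n. r \<le> \<rho> n" if "r < 1" for r
    using reals_power_lt_ex[of "1 - r" 2] that by (smt (verit) power_one_over)
  have step: "cmod (poly (U (Suc n)) z - poly (U n) z) \<le> \<eta> n"
    "cmod (poly (V (Suc n)) z - poly (V n) z) \<le> \<eta> n"
    "cmod (poly (S (Suc n)) z - poly (S n) z) \<le> \<eta> n"
    "cmod (poly (pderiv (U (Suc n))) z - poly (pderiv (U n)) z) \<le> \<eta> n"
    "cmod (poly (pderiv (V (Suc n))) z - poly (pderiv (V n)) z) \<le> \<eta> n"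
    if "cmod z \<le> \<rho> n" for n z
    using nxt[of n] that by blast+
  obtain f f' where f: "\<And>z. z \<in> ball 0 1 \<Longrightarrow> (f has_field_derivative f' z) (at z)"
    "\<And>z. z \<in> ball 0 1 \<Longrightarrow> (\<lambda>n. poly (U n) z) \<longlonglongrightarrow> f z"
    "\<And>z. z \<in> ball 0 1 \<Longrightarrow> (\<lambda>n. poly (pderiv (U n)) z) \<longlonglongrightarrow> f' z"
    using poly_sequence_limit[of \<rho> U \<eta>, OF step(1) \<eta>(3,1) \<eta>0 incr exh] by blast
  obtain g g' where g: "\<And>z. z \<in> ball 0 1 \<Longrightarrow> (g has_field_derivative g' z) (at z)"
    "\<And>z. z \<in> ball 0 1 \<Longrightarrow> (\<lambda>n. poly (V n) z) \<longlonglongrightarrow> g z"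
    "\<And>z. z \<in> ball 0 1 \<Longrightarrow> (\<lambda>n. poly (pderiv (V n)) z) \<longlonglongrightarrow> g' z"
    using poly_sequence_limit[of \<rho> V \<eta>, OF step(2) \<eta>(3,1) \<eta>0 incr exh] by blast
  obtain h h' where h: "\<And>z. z \<in> ball 0 1 \<Longrightarrow> (h has_field_derivative h' z) (at z)"
    "\<And>z. z \<in> ball 0 1 \<Longrightarrow> (\<lambda>n. poly (S n) z) \<longlonglongrightarrow> h z"
    "\<And>z. z \<in> ball 0 1 \<Longrightarrow> (\<lambda>n. poly (pderiv (S n)) z) \<longlonglongrightarrow> h' z"
    using poly_sequence_limit[of \<rho> S \<eta>, OF step(3) \<eta>(3,1) \<eta>0 incr exh] by blast
  have h': "h' z = g z * f' z - f z * g' z" if z: "z \<in> ball 0 1" for z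
  proof (rule LIMSEQ_unique[OF h(3)[OF z]])
    show "(\<lambda>n. poly (pderiv (S n)) z) \<longlonglongrightarrow> g z * f' z - f z * g' z"
      unfolding leg poly_diff poly_mult by (intro tendsto_intros f g z)
  qed
  have disc: "cmod (poly y z) \<le> 2" if y: "\<And>z. cmod z = 1 \<Longrightarrow> cmod (poly y z) \<le> 2" and z: "z \<in> ball 0 1" for y z
    by (rule maximum_modulus_frontier[of "poly y" "ball 0 1"])
       (use y z in \<open>auto intro!: holomorphic_intros continuous_intros simp: frontier_ball\<close>)
  have bd: "cmod (poly (U n) z) \<le> 2" "cmod (poly (V n) z) \<le> 2" "cmod (poly (S n) z) \<le> 2"
    if z: "z \<in> ball 0 1" for n z
  proof -
    have "Phi (poly (U n) z) (poly (V n) z) (poly (S n) z) \<le> 3/8" if "cmod z = 1" for z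
    proof -
      have "\<bar>Phi (poly (U n) z) (poly (V n) z) (poly (S n) z) - 1/4\<bar> \<le> 1/8 - 1 / (8 * (real n + 2))"
        using inv[of n] that by blast
      moreover have "0 \<le> 1 / (8 * (real n + 2))" by simp
      ultimately show ?thesis unfolding abs_le_iff by linarith
    qed
    note b = Phi_bounds(3-5)[OF this]
    show "cmod (poly (U n) z) \<le> 2" "cmod (poly (V n) z) \<le> 2" "cmod (poly (S n) z) \<le> 2"
      by (rule disc[OF b(1) z] disc[OF b(2) z] disc[OF b(3) z]; assumption)+
  qed
  have bounded: "cmod (f z) \<le> 2 \<and> cmod (g z) \<le> 2 \<and> cmod (h z) \<le> 2" if z: "z \<in> ball 0 1" for z
    using bd[OF z] f(2)[OF z] g(2)[OF z] h(2)[OF z]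
    by (intro conjI LIMSEQ_le_const2[OF tendsto_norm]) auto
  \<comment> \<open>After stage n each of the two derivatives moves by at most 2 \<eta> n.\<close>
  have lower: "cmod (poly (pderiv (U n)) z) + cmod (poly (pderiv (V n)) z) - 4 * \<eta> n \<le> cmod (f' z) + cmod (g' z)"
    if z: "cmod z \<le> \<rho> n" for n z
  proof -
    have zb: "z \<in> ball 0 1" using z \<rho>01(2)[of n] by simp
    have zk: "cmod z \<le> \<rho> k" if "n \<le> k" for k using z incr that by (meson incseqD order_trans)
    have "cmod (f' z - poly (pderiv (U n)) z) \<le> 2 * \<eta> n"
    proof (rule LIMSEQ_le_const2)
      show "(\<lambda>m. cmod (poly (pderiv (U m)) z - poly (pderiv (U n)) z)) \<longlonglongrightarrow> cmod (f' z - poly (pderiv (U n)) z)"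
        by (intro tendsto_intros f zb)
      show "\<exists>N. \<forall>m\<ge>N. cmod (poly (pderiv (U m)) z - poly (pderiv (U n)) z) \<le> 2 * \<eta> n"
        using geometric_telescope[where F = "\<lambda>n. poly (pderiv (U n)) z"] step(4)[OF zk] \<eta>(1,3) by blast
    qed
    moreover have "cmod (g' z - poly (pderiv (V n)) z) \<le> 2 * \<eta> n"
    proof (rule LIMSEQ_le_const2)
      show "(\<lambda>m. cmod (poly (pderiv (V m)) z - poly (pderiv (V n)) z)) \<longlonglongrightarrow> cmod (g' z - poly (pderiv (V n)) z)"
        by (intro tendsto_intros g zb)
      show "\<exists>N. \<forall>m\<ge>N. cmod (poly (pderiv (V m)) z - poly (pderiv (V n)) z) \<le> 2 * \<eta> n"
        using geometric_telescope[where F = "\<lambda>n. poly (pderiv (V n)) z"] step(5)[OF zk] \<eta>(1,3) by blast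
    qed
    ultimately show ?thesis
      using norm_triangle_ineq3[of "f' z" "poly (pderiv (U n)) z"]
        norm_triangle_ineq3[of "g' z" "poly (pderiv (V n)) z"] unfolding abs_le_iff by linarith
  qed
  have nz: "f' z \<noteq> 0 \<or> g' z \<noteq> 0" if z: "z \<in> ball 0 1" for z
  proof -
    obtain n where n: "cmod z \<le> \<rho> n" using exh[of "cmod z"] z by auto
    then have "4 * \<eta> n < cmod (poly (pderiv (U n)) z) + cmod (poly (pderiv (V n)) z)"
      using inv[of n] by blast
    then show ?thesis using lower[OF n] by auto
  qed
  have "\<forall>n. \<exists>p q. \<rho> n \<le> p \<and> p < q \<and> q \<le> \<rho> (Suc n) \<and> (\<forall>z. p \<le> cmod z \<longrightarrow> cmod z \<le> q \<longrightarrow>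
          1 / (8000 * (real n + 3)) / (q - p) + 4 * \<eta> (Suc n)
            \<le> cmod (poly (pderiv (U (Suc n))) z) + cmod (poly (pderiv (V (Suc n))) z))"
    using nxt by blast
  then obtain p q where pq: "\<And>n. \<rho> n \<le> p n" "\<And>n. p n < q n" "\<And>n. q n \<le> \<rho> (Suc n)"
     "\<And>n z. p n \<le> cmod z \<Longrightarrow> cmod z \<le> q n \<Longrightarrow>
          1 / (8000 * (real n + 3)) / (q n - p n) + 4 * \<eta> (Suc n)
            \<le> cmod (poly (pderiv (U (Suc n))) z) + cmod (poly (pderiv (V (Suc n))) z)"
    by metis
  show thesis
  proof (rule that[OF f(1) g(1) _ bounded nz pq(2)])
    show "(h has_field_derivative (g z * f' z - f z * g' z)) (at z)" if "z \<in> ball 0 1" for z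
      using h(1)[OF that] h'[OF that] by simp
    show "q n \<le> p (Suc n)" for n using pq(1,3) order_trans by blast
    show "q n < 1" for n using pq(3)[of n] \<rho>01(2)[of "Suc n"] by linarith
    show "\<exists>n. r \<le> p n" if "r < 1" for r using exh[OF that] pq(1) order_trans by blast
    \<comment> \<open>The n-th annulus belongs to stage n + 1 and lies in its disc, so
      \<open>lower\<close> applies at \<open>Suc n\<close> and subtracts exactly the reserve kept in
      \<open>pq(4)\<close>.\<close>
    show "1 / (8000 * (real n + 3)) / (q n - p n) \<le> cmod (f' z) + cmod (g' z)"
      if "p n \<le> cmod z" "cmod z \<le> q n" for n z
      using pq(4)[OF that] lower[of z "Suc n"] pq(3)[of n] that(2) by linarith
  qed
qed

section \<open>Two by two complex matrices\<close>

lemma matrix_mult_nth_2: "((A :: complex^2^2) ** B) $ i $ j = A $ i $ 1 * B $ 1 $ j + A $ i $ 2 * B $ 2 $ j"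
  by (simp add: matrix_matrix_mult_def sum_2)

lemma matrix_eq_2I:
  fixes A B :: "complex^2^2"
  assumes "A $ 1 $ 1 = B $ 1 $ 1" "A $ 1 $ 2 = B $ 1 $ 2" "A $ 2 $ 1 = B $ 2 $ 1" "A $ 2 $ 2 = B $ 2 $ 2"
  shows "A = B"
  using assms by (simp add: vec_eq_iff forall_2)

text \<open>The trace formula is the Frobenius norm, and so is the Euclidean norm of nested
  vectors.\<close>

lemma matrix_abs_eq_norm: "matrix_abs A = norm A"
proof -
  have "Re (trace (A ** matrix_adjoint A)) = (\<Sum>i\<in>UNIV. \<Sum>j\<in>UNIV. (cmod (A $ i $ j))\<^sup>2)"
    by (simp add: trace_def matrix_mult_nth_2 matrix_adjoint_def sum_2 complex_mult_cnj cmod_power2)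
  moreover have "(norm A)\<^sup>2 = (\<Sum>i\<in>UNIV. \<Sum>j\<in>UNIV. (cmod (A $ i $ j))\<^sup>2)"
    by (simp add: norm_vec_def L2_set_def sum_nonneg)
  ultimately show ?thesis
    unfolding matrix_abs_def by (metis norm_ge_zero real_sqrt_unique)
qed

lemma norm_matrix_entry_le: "cmod ((A :: complex^2^2) $ i $ j) \<le> norm A"
  by (rule order_trans[OF Finite_Cartesian_Product.norm_nth_le Finite_Cartesian_Product.norm_nth_le])

text \<open>The constant counts four entries, each a sum of two products.\<close>

lemma norm_matrix_mult_le: "norm ((A :: complex^2^2) ** (B :: complex^2^2)) \<le> 8 * (norm A * norm B)"
proof -
  have entry: "cmod ((A ** B) $ i $ j) \<le> 2 * (norm A * norm B)" for i j
  proof -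
    have "cmod (A $ i $ k * B $ k $ j) \<le> norm A * norm B" for k
      unfolding norm_mult by (intro mult_mono norm_matrix_entry_le) auto
    then show ?thesis
      unfolding matrix_mult_nth_2
      using norm_triangle_ineq[of "A $ i $ 1 * B $ 1 $ j" "A $ i $ 2 * B $ 2 $ j"]
      by (smt (verit))
  qed
  have "norm (A ** B) \<le> (\<Sum>i\<in>UNIV. norm ((A ** B) $ i))"
    unfolding norm_vec_def[of "A ** B"] by (rule L2_set_le_sum) simp
  also have "\<dots> \<le> (\<Sum>i\<in>UNIV. \<Sum>j\<in>UNIV. cmod ((A ** B) $ i $ j))"
    by (intro sum_mono) (simp add: norm_vec_def L2_set_le_sum)
  also have "\<dots> \<le> 8 * (norm A * norm B)"
    using entry[of 1 1] entry[of 1 2] entry[of 2 1] entry[of 2 2] by (simp add: sum_2)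
  finally show ?thesis .
qed

lemma continuous_on_matrix:
  fixes E :: "'a::topological_space \<Rightarrow> complex^2^2"
  assumes "\<And>i j. continuous_on S (\<lambda>x. E x $ i $ j)"
  shows "continuous_on S E"
proof -
  have "continuous_on S (\<lambda>x. \<chi> i j. E x $ i $ j)"
    by (intro continuous_intros assms)
  then show ?thesis by simp
qed

lemma continuous_on_matrix_2I:
  fixes E :: "'a::topological_space \<Rightarrow> complex^2^2"
  assumes "continuous_on S (\<lambda>x. E x $ 1 $ 1)" "continuous_on S (\<lambda>x. E x $ 1 $ 2)"
    "continuous_on S (\<lambda>x. E x $ 2 $ 1)" "continuous_on S (\<lambda>x. E x $ 2 $ 2)"
  shows "continuous_on S E"
proof (rule continuous_on_matrix)
  show "continuous_on S (\<lambda>x. E x $ i $ j)" for i j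
    using exhaust_2[of i] exhaust_2[of j] assms by auto
qed

lemma matrix_inv_mult:
  fixes A :: "complex^2^2"
  assumes "det A = 1"
  shows "A ** matrix_inv A = mat 1" "matrix_inv A ** A = mat 1"
proof -
  have "invertible A" using assms by (simp add: invertible_det_nz)
  then have "\<exists>A'. A ** A' = mat 1 \<and> A' ** A = mat 1" by (simp add: invertible_def)
  then have "A ** matrix_inv A = mat 1 \<and> matrix_inv A ** A = mat 1"
    unfolding matrix_inv_def by (rule someI_ex)
  then show "A ** matrix_inv A = mat 1" "matrix_inv A ** A = mat 1" by auto
qed

text \<open>At determinant 1 the inverse is the adjugate, whose entries are linear in those of A;
  continuity of the density rests on this.\<close>

lemma matrix_inv_SL2:
  fixes A :: "complex^2^2"
  assumes "det A = 1"
  shows "matrix_inv A = vector [vector [A $ 2 $ 2, - A $ 1 $ 2], vector [- A $ 2 $ 1, A $ 1 $ 1]]"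
    (is "_ = ?B")
proof -
  have "A ** ?B = mat 1"
    using assms by (intro matrix_eq_2I) (simp_all add: matrix_mult_nth_2 mat_def det_2 algebra_simps)
  then have "matrix_inv A ** (A ** ?B) = matrix_inv A" by simp
  then show ?thesis by (simp add: matrix_mul_assoc matrix_inv_mult[OF assms])
qed

lemma continuous_on_SL_density:
  assumes E: "holomorphic_matrix_on E D" "open D" "\<And>z. z \<in> D \<Longrightarrow> E z \<in> SL2C"
  shows "continuous_on D (SL_density E)"
proof -
  have hol: "(\<lambda>z. E z $ i $ j) holomorphic_on D" for i j
    using E(1) by (simp add: holomorphic_matrix_on_def)
  have c1: "continuous_on D (\<lambda>z. E z $ i $ j)" for i j
    by (rule holomorphic_on_imp_continuous_on[OF hol])
  have c2: "continuous_on D (\<lambda>z. matrix_deriv E z $ i $ j)" for i j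
    unfolding matrix_deriv_def
    using holomorphic_on_imp_continuous_on[OF holomorphic_deriv[OF hol E(2)]] by simp
  have "continuous_on D (\<lambda>z. norm (vector [vector [E z $ 2 $ 2, - E z $ 1 $ 2],
      vector [- E z $ 2 $ 1, E z $ 1 $ 1]] ** matrix_deriv E z :: complex^2^2))"
    by (intro continuous_on_norm continuous_on_matrix_2I)
       (simp_all add: matrix_mult_nth_2 c1 c2 continuous_intros)
  then show ?thesis
    by (rule continuous_on_eq)
       (use E(3) in \<open>auto simp: SL_density_def matrix_abs_eq_norm matrix_inv_SL2 SL2C_def\<close>)
qed

section \<open>Darboux coordinates\<close>

text \<open>In these coordinates the contact form is \<open>v du - dt\<close>.\<close>

definition darboux :: "complex \<Rightarrow> complex \<Rightarrow> complex \<Rightarrow> complex^2^2" where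
  "darboux u v t = vector [vector [exp t, u * exp t], vector [v * exp (- t), (1 + u * v) * exp (- t)]]"

text \<open>The derivative of \<open>darboux\<close> along a curve, with t' = v u' already
  substituted. Its second row is a multiple of (1, u), as is the first row of
  \<open>darboux\<close>.\<close>

definition darboux_deriv :: "complex \<Rightarrow> complex \<Rightarrow> complex \<Rightarrow> complex \<Rightarrow> complex \<Rightarrow> complex^2^2" where
  "darboux_deriv u v t u' v' = vector [vector [v * u' * exp t, (u' + u * v * u') * exp t],
     vector [(v' - v\<^sup>2 * u') * exp (- t), u * ((v' - v\<^sup>2 * u') * exp (- t))]]"

lemma darboux_nth [simp]:
  "darboux u v t $ 1 $ 1 = exp t" "darboux u v t $ 1 $ 2 = u * exp t"
  "darboux u v t $ 2 $ 1 = v * exp (- t)" "darboux u v t $ 2 $ 2 = (1 + u * v) * exp (- t)"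
  by (simp_all add: darboux_def)

lemma darboux_deriv_nth [simp]:
  "darboux_deriv u v t u' v' $ 1 $ 1 = v * u' * exp t"
  "darboux_deriv u v t u' v' $ 1 $ 2 = (u' + u * v * u') * exp t"
  "darboux_deriv u v t u' v' $ 2 $ 1 = (v' - v\<^sup>2 * u') * exp (- t)"
  "darboux_deriv u v t u' v' $ 2 $ 2 = u * ((v' - v\<^sup>2 * u') * exp (- t))"
  by (simp_all add: darboux_deriv_def)

lemma det_darboux: "det (darboux u v t) = 1"
proof -
  have "exp t * exp (- t) = 1" by (simp add: exp_minus)
  then show ?thesis by (simp add: det_2 algebra_simps)
qed

lemma has_field_derivative_darboux:
  assumes "(u has_field_derivative u') (at z)" "(v has_field_derivative v') (at z)"
    "(t has_field_derivative (v z * u')) (at z)"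
  shows "((\<lambda>w. (darboux (u w) (v w) (t w) ** A) $ i $ j) has_field_derivative
     (darboux_deriv (u z) (v z) (t z) u' v' ** A) $ i $ j) (at z)"
proof -
  note [derivative_intros] = assms
  have "((\<lambda>w. darboux (u w) (v w) (t w) $ i $ j) has_field_derivative
     darboux_deriv (u z) (v z) (t z) u' v' $ i $ j) (at z)" for i j
    using exhaust_2[of i] exhaust_2[of j]
    by (auto intro!: derivative_eq_intros simp: algebra_simps power2_eq_square)
  note [derivative_intros] = this
  show ?thesis
    unfolding matrix_mult_nth_2 by (auto intro!: derivative_eq_intros)
qed

text \<open>\<open>Omega_SL x v\<close> is the determinant of the first row of x and the second row
  of v. Right multiplication by A multiplies it by det A, and before it the two rows are
  parallel.\<close>

lemma Omega_SL_darboux_deriv: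
  "Omega_SL (darboux u v t ** A) (\<chi> i j. c * (darboux_deriv u v t u' v' ** A) $ i $ j) = 0"
  by (simp add: Omega_SL_def matrix_mult_nth_2 algebra_simps)

text \<open>With N the norm on the right, entry (1, 2) is u' times a factor of modulus at least 1/4,
  so |u'| \<le> 4 N; entry (2, 1) gives |v' - v^2 u'| \<le> 2 N. The total is 4 + (2 + 4) =
  10.\<close>

lemma norm_darboux_deriv_ge:
  assumes "cmod u \<le> 1/2" "cmod v \<le> 1/2" "cmod t \<le> 1/2"
  shows "cmod u' + cmod v' \<le> 10 * norm (darboux_deriv u v t u' v')"
proof -
  let ?N = "norm (darboux_deriv u v t u' v')"
  have e: "1/2 \<le> cmod (exp x)" if "cmod x \<le> 1/2" for x :: complex
    using abs_Re_le_cmod[of x] that exp_ge_add_one_self[of "Re x"] unfolding norm_exp_eq_Re by linarith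
  have uv: "cmod (u * v) \<le> 1/2 * (1/2)"
    unfolding norm_mult using assms by (intro mult_mono) auto
  then have "1/2 \<le> cmod (1 + u * v)"
    using norm_triangle_ineq2[of 1 "- (u * v)"] by simp
  then have "cmod u' * (1/2) * (1/2) \<le> cmod u' * cmod (1 + u * v) * cmod (exp t)"
    using e[OF assms(3)] by (intro mult_mono) auto
  also have "\<dots> = cmod (darboux_deriv u v t u' v' $ 1 $ 2)"
  proof -
    have "u' * (1 + u * v) * exp t = darboux_deriv u v t u' v' $ 1 $ 2" by (simp add: algebra_simps)
    then show ?thesis by (metis norm_mult)
  qed
  also have "\<dots> \<le> ?N" by (rule norm_matrix_entry_le)
  finally have 1: "cmod u' \<le> 4 * ?N" by simp
  have "cmod (v' - v\<^sup>2 * u') * (1/2) \<le> cmod (v' - v\<^sup>2 * u') * cmod (exp (- t))"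
    using e[of "- t"] assms(3) by (intro mult_left_mono) auto
  also have "\<dots> = cmod (darboux_deriv u v t u' v' $ 2 $ 1)" by (simp add: norm_mult)
  also have "\<dots> \<le> ?N" by (rule norm_matrix_entry_le)
  finally have 2: "cmod (v' - v\<^sup>2 * u') \<le> 2 * ?N" by simp
  have "cmod (v\<^sup>2 * u') \<le> 1 * cmod u'"
    unfolding norm_mult norm_power using assms(2) by (intro mult_right_mono power_le_one) auto
  then have "cmod v' \<le> cmod (v' - v\<^sup>2 * u') + cmod u'"
    using norm_triangle_ineq[of "v' - v\<^sup>2 * u'" "v\<^sup>2 * u'"] by simp
  then show ?thesis using 1 2 by simp
qed

lemma darboux_mult_near:
  fixes A :: "complex^2^2"
  assumes "open T" "A \<in> T"
  obtains \<delta> where "0 < \<delta>" "\<And>u v t. cmod u \<le> \<delta> \<Longrightarrow> cmod v \<le> \<delta> \<Longrightarrow> cmod t \<le> \<delta> \<Longrightarrow> darboux u v t ** A \<in> T"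
proof -
  have "continuous_on UNIV (\<lambda>(u, v, t). darboux u v t ** A)"
    unfolding case_prod_beta
    by (rule continuous_on_matrix_2I) (simp_all add: matrix_mult_nth_2, (intro continuous_intros)+)
  then have "open ((\<lambda>(u, v, t). darboux u v t ** A) -` T)"
    by (simp add: assms(1) open_vimage)
  moreover have "darboux 0 0 0 ** A = A" by (rule matrix_eq_2I) (simp_all add: matrix_mult_nth_2)
  then have "(0, 0, 0) \<in> (\<lambda>(u, v, t). darboux u v t ** A) -` T" using assms(2) by simp
  ultimately obtain e where e: "0 < e" "ball (0, 0, 0) e \<subseteq> (\<lambda>(u, v, t). darboux u v t ** A) -` T"
    using open_contains_ball by blast
  show thesis
  proof (rule that[of "e / 4"])
    fix u v t assume b: "cmod u \<le> e / 4" "cmod v \<le> e / 4" "cmod t \<le> e / 4"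
    have "norm (u, v, t) \<le> cmod u + norm (v, t)" by (rule norm_Pair_le)
    also have "norm (v, t) \<le> cmod v + cmod t" by (rule norm_Pair_le)
    finally have "norm (u, v, t) < e" using b e(1) by simp
    then have "(u, v, t) \<in> ball (0, 0, 0) e"
      unfolding mem_ball zero_prod_def[symmetric] dist_0_norm .
    then show "darboux u v t ** A \<in> T" using e(2) by auto
  qed (use e in simp)
qed

section \<open>A curve inside the given domain\<close>

theorem mainTheorem1:
  fixes U :: "(complex^2^2) set"
  assumes "U \<subseteq> SL2C"
    and "openin (top_of_set SL2C) U"
    and "connected U"
    and "bounded U"
    and "U \<noteq> {}"
  shows "\<exists>E :: complex \<Rightarrow> complex^2^2.
           holomorphic_matrix_on E (ball 0 1)
         \<and> (\<forall>z\<in>ball 0 1. E z \<in> SL2C)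
         \<and> immersion_on E (ball 0 1)
         \<and> Legendrian_on E (ball 0 1)
         \<and> complete_on E (ball 0 1)
         \<and> E ` ball 0 1 \<subseteq> U"
proof (rule bounded_oscillating_legendrian_curve)
  let ?D = "ball 0 1 :: complex set"
  obtain A where A: "A \<in> U" using assms(5) by blast
  then have detA: "det A = 1" using assms(1) by (auto simp: SL2C_def)
  obtain T where T: "open T" "U = SL2C \<inter> T" using assms(2) by (auto simp: openin_open)
  then have "A \<in> T" using A by blast
  obtain \<delta> where \<delta>: "0 < \<delta>"
    "\<And>u v t. cmod u \<le> \<delta> \<Longrightarrow> cmod v \<le> \<delta> \<Longrightarrow> cmod t \<le> \<delta> \<Longrightarrow> darboux u v t ** A \<in> T"
    using darboux_mult_near[OF T(1) \<open>A \<in> T\<close>] by blast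
  obtain M where M: "0 < M" "\<And>X. X \<in> U \<Longrightarrow> norm X \<le> M"
    using assms(4) bounded_pos[of U] by blast
  fix f f' g g' h :: "complex \<Rightarrow> complex" and p q :: "nat \<Rightarrow> real"
  assume f: "\<And>z. z \<in> ?D \<Longrightarrow> (f has_field_derivative f' z) (at z)"
    and g: "\<And>z. z \<in> ?D \<Longrightarrow> (g has_field_derivative g' z) (at z)"
    and h: "\<And>z. z \<in> ?D \<Longrightarrow> (h has_field_derivative (g z * f' z - f z * g' z)) (at z)"
    and bd: "\<And>z. z \<in> ?D \<Longrightarrow> cmod (f z) \<le> 2 \<and> cmod (g z) \<le> 2 \<and> cmod (h z) \<le> 2"
    and nz: "\<And>z. z \<in> ?D \<Longrightarrow> f' z \<noteq> 0 \<or> g' z \<noteq> 0"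
    and band: "\<And>n. p n < q n" "\<And>n. q n \<le> p (Suc n)" "\<And>n. q n < 1" "\<And>r. r < 1 \<Longrightarrow> \<exists>n. r \<le> p n"
    and osc: "\<And>n z. p n \<le> cmod z \<Longrightarrow> cmod z \<le> q n \<Longrightarrow>
       1 / (8000 * (real n + 3)) / (q n - p n) \<le> cmod (f' z) + cmod (g' z)"
  \<comment> \<open>All three coordinates will be at most 2 \<epsilon>: below 1/2 for
    \<open>norm_darboux_deriv_ge\<close> and below \<delta> to stay in T.\<close>
  define \<epsilon> where "\<epsilon> = min (1/4) (\<delta> / 3)"
  have \<epsilon>: "0 < \<epsilon>" "\<epsilon> \<le> 1/4" "3 * \<epsilon> \<le> \<delta>" using \<delta>(1) by (auto simp: \<epsilon>_def)
  define e where "e = complex_of_real \<epsilon>"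
  have e: "cmod e = \<epsilon>" using \<epsilon> by (simp add: e_def)
  \<comment> \<open>By the product rule for f g, the relation h' = g f' - f g' becomes t' = v u'.
    The factor 1/2 belongs to this change of form, e^2 to the weighted scaling.\<close>
  define u v t where "u z = e * f z" and "v z = e * g z" and "t z = e\<^sup>2 / 2 * (h z + f z * g z)" for z
  define E where "E z = darboux (u z) (v z) (t z) ** A" for z
  define dF where "dF z = darboux_deriv (u z) (v z) (t z) (e * f' z) (e * g' z)" for z
  have du: "(u has_field_derivative e * f' z) (at z)" and dv: "(v has_field_derivative e * g' z) (at z)"
    and dt: "(t has_field_derivative v z * (e * f' z)) (at z)" if z: "z \<in> ?D" for z
    unfolding u_def v_def t_def
    by (auto intro!: derivative_eq_intros f[OF z] g[OF z] h[OF z] simp: field_simps power2_eq_square)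
  have dE: "((\<lambda>w. E w $ i $ j) has_field_derivative (dF z ** A) $ i $ j) (at z)" if "z \<in> ?D" for z i j
    unfolding E_def dF_def by (rule has_field_derivative_darboux[OF du[OF that] dv[OF that] dt[OF that]])
  then have mE: "matrix_deriv E z = dF z ** A" if "z \<in> ?D" for z
    using that by (simp add: matrix_deriv_def vec_eq_iff DERIV_imp_deriv)
  have hol: "holomorphic_matrix_on E ?D"
    unfolding holomorphic_matrix_on_def holomorphic_on_open[OF open_ball] using dE by blast
  have det: "det (E z) = 1" for z by (simp add: E_def det_mul det_darboux detA)
  then have SL: "E z \<in> SL2C" for z by (simp add: SL2C_def)
  have small: "cmod (u z) \<le> 2 * \<epsilon>" "cmod (v z) \<le> 2 * \<epsilon>" "cmod (t z) \<le> 2 * \<epsilon>" if z: "z \<in> ?D" for z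
  proof -
    show "cmod (u z) \<le> 2 * \<epsilon>" "cmod (v z) \<le> 2 * \<epsilon>"
      using bd[OF z] \<epsilon> by (simp_all add: u_def v_def norm_mult e mult.commute[of _ \<epsilon>])
    have "cmod (f z * g z) \<le> 2 * 2"
      unfolding norm_mult using bd[OF z] by (intro mult_mono) auto
    then have "cmod (h z + f z * g z) \<le> 6"
      using bd[OF z] norm_triangle_ineq[of "h z" "f z * g z"] by linarith
    then have "\<epsilon> * \<epsilon> / 2 * cmod (h z + f z * g z) \<le> \<epsilon> * (1/4) / 2 * 6"
      using \<epsilon> by (intro mult_mono divide_right_mono) auto
    then show "cmod (t z) \<le> 2 * \<epsilon>"
      using \<epsilon> by (simp add: t_def norm_mult norm_divide norm_power e power2_eq_square)
  qed
  have EU: "E z \<in> U" if z: "z \<in> ?D" for z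
    unfolding T(2) E_def using \<delta>(2)[of "u z" "v z" "t z"] small[OF z] \<epsilon> SL[of z] by (auto simp: E_def)
  \<comment> \<open>In dF = E (E^-1 E') A^-1 the two outer products cost 8 * 8, |E| \<le> M holds
    because U is bounded, and the remaining 10 comes from
    \<open>norm_darboux_deriv_ge\<close>.\<close>
  define K where "K = 640 * M * norm (matrix_inv A)"
  have K: "\<epsilon> * (cmod (f' z) + cmod (g' z)) \<le> K * SL_density E z" if z: "z \<in> ?D" for z
  proof -
    let ?G = "matrix_inv (E z) ** matrix_deriv E z"
    have "dF z = matrix_deriv E z ** matrix_inv A"
      by (simp add: mE[OF z] matrix_mul_assoc[symmetric] matrix_inv_mult[OF detA])
    also have "matrix_deriv E z = E z ** ?G"
      by (simp add: matrix_mul_assoc matrix_inv_mult[OF det])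
    finally have "norm (dF z) \<le> 8 * (norm (E z ** ?G) * norm (matrix_inv A))"
      using norm_matrix_mult_le by simp
    also have "\<dots> \<le> 8 * (8 * (M * norm ?G) * norm (matrix_inv A))"
      using M EU[OF z]
      by (intro mult_left_mono mult_right_mono order_trans[OF norm_matrix_mult_le] mult_mono) auto
    finally have "10 * norm (dF z) \<le> K * SL_density E z"
      by (simp add: K_def SL_density_def matrix_abs_eq_norm algebra_simps)
    moreover have "cmod (e * f' z) + cmod (e * g' z) \<le> 10 * norm (dF z)"
      unfolding dF_def using small[OF z] \<epsilon> by (intro norm_darboux_deriv_ge) auto
    ultimately show ?thesis by (simp add: norm_mult e algebra_simps)
  qed
  have "0 < cmod (f' z) + cmod (g' z)" if "z \<in> ?D" for z
    using nz[OF that] by (auto simp: add_pos_nonneg add_nonneg_pos)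
  then have Kpos: "0 < K * SL_density E z" if "z \<in> ?D" for z
    using K[OF that] \<epsilon>(1) that by (meson less_le_trans mult_pos_pos)
  have "0 \<le> K" using M by (simp add: K_def)
  moreover have "K \<noteq> 0" using Kpos[of 0] by auto
  ultimately have "0 < K" by simp
  have pos: "0 < SL_density E z" if "z \<in> ?D" for z
    using Kpos[OF that] \<open>0 < K\<close> by (simp add: zero_less_mult_iff)
  have "complete_conformal_metric ?D (SL_density E)"
  proof (rule complete_conformal_metric_bands[where p = p and q = q
        and b = "\<lambda>n. \<epsilon> / K / 8000 * (1 / (real n + 3))"])
    show "continuous_on ?D (SL_density E)"
      by (rule continuous_on_SL_density[OF hol]) (use SL in auto)
    show "\<epsilon> / K / 8000 * (1 / (real n + 3)) / (q n - p n) \<le> SL_density E z"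
      if z: "p n \<le> cmod z" "cmod z \<le> q n" for n z
    proof -
      have "z \<in> ?D" using z band(3)[of n] by simp
      have "\<epsilon> * (1 / (8000 * (real n + 3)) / (q n - p n)) \<le> \<epsilon> * (cmod (f' z) + cmod (g' z))"
        using osc[OF z] \<epsilon> by (intro mult_left_mono) auto
      also have "\<dots> \<le> K * SL_density E z" by (rule K) fact
      finally have "\<epsilon> * (1 / (8000 * (real n + 3)) / (q n - p n)) / K \<le> SL_density E z"
        unfolding pos_divide_le_eq[OF \<open>0 < K\<close>] by (simp only: mult.commute)
      moreover have "\<epsilon> * (1 / (8000 * x) / y) / K = \<epsilon> / K / 8000 * (1 / x) / y" for x y by simp
      ultimately show ?thesis by (simp only:)
    qed
    show "\<not> summable (\<lambda>n. \<epsilon> / K / 8000 * (1 / (real n + 3)))"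
    proof
      assume "summable (\<lambda>n. \<epsilon> / K / 8000 * (1 / (real n + 3)))"
      then have "summable (\<lambda>n. 1 / (real n + 3))"
        using \<epsilon>(1) \<open>0 < K\<close> by (subst (asm) summable_cmult_iff) auto
      then have "summable (\<lambda>n. inverse (real (n + 3)))" by (simp add: inverse_eq_divide)
      then show False using not_summable_harmonic[where 'a = real] by (subst (asm) summable_iff_shift) auto
    qed
  qed (use pos band \<epsilon> \<open>0 < K\<close> in auto)
  moreover have "immersion_on E ?D"
    unfolding immersion_on_def
  proof
    fix z assume z: "z \<in> ?D"
    have "matrix_deriv E z \<noteq> 0"
      using pos[OF z] by (auto simp: SL_density_def matrix_abs_eq_norm)
    then obtain i j where "matrix_deriv E z $ i $ j \<noteq> 0" by (auto simp: vec_eq_iff)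
    then show "inj (frechet_derivative E (at z))"
      unfolding frechet_derivative_holomorphic_matrix[OF hol open_ball z]
      by (auto simp: inj_def vec_eq_iff)
  qed
  moreover have "Legendrian_on E ?D"
    unfolding Legendrian_on_def
  proof (intro ballI allI)
    fix z c assume z: "z \<in> ?D"
    show "Omega_SL (E z) (frechet_derivative E (at z) c) = 0"
      unfolding frechet_derivative_holomorphic_matrix[OF hol open_ball z] mE[OF z]
      unfolding E_def dF_def by (rule Omega_SL_darboux_deriv)
  qed
  ultimately show ?thesis
    using hol SL EU unfolding complete_on_def by blast
qed

end
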